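(* Let $(X,S,\mu)$ be an ergodic measure-preserving system on a compact metric (Borel) space $X$ with $h(S,\mu)>0$, and let $\mathcal A$ be a finite partition of $X$ such that $\bigvee_{i\ge0}S^{-i}\mathcal A$ generates the Borel $\sigma$-algebra and $\mu$ gives zero measure to the boundaries of all sets in $S^{-i}\mathcal A$, $i\in\mathbb{N}$. Let $\varepsilon\in(0,1)$ and let $\alpha\in(0,1)$ be irrational. Then for every $\delta\in(0,1)$ there exist a constant $c_\delta>0$ and a set $X'_\delta\subset X$ with $\mu(X'_\delta)=1$ such that: for every $n\ge1$, every $x\in X'_\delta$ and every $K\subset\mathbb{N}$ with lower natural density $\rho>2\delta+\varepsilon$, there is a collection $\mathcal M_n=\mathcal M_n(x,K)$ of at most $c_\delta2^{n\delta}$ atoms of $\bigvee_{i=0}^nS^{-i}\mathcal A$, with union $M_n$, such that, setting $K'(x)=\{k\in\mathbb{N}:S^kx\in M_n\}$, the set \[ A_{K\cap K'(x)}(\alpha)=\overline{\{\{k\alpha\}:k\in K\cap K'(x)\}} \] has Lebesgue measure at least $\varepsilon$.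
   Context: $h(S,\mu)$ is the measure-theoretic entropy. $\bigvee_{i=0}^nS^{-i}\mathcal A$ is the partition generated by the sets $S^{-i}A$, $A\in\mathcal A$, $0\le i\le n$; its atoms are the nonempty sets $\{x: x\in A_0, Sx\in A_1,\dots,S^nx\in A_n\}$ with $A_j\in\mathcal A$. $\{x\}$ is the fractional part; lower natural density of $K$ is $\liminf_n\#(K\cap[1,n])/n$. *)

theory Defs
  imports "HOL-Probability.Probability"
begin

definition fin_partition :: "'a measure \<Rightarrow> 'a set set \<Rightarrow> bool" where
  "fin_partition M P \<longleftrightarrow> finite P \<and> P \<subseteq> sets M \<and> \<Union>P = space M \<and>
     (\<forall>A\<in>P. \<forall>B\<in>P. A \<noteq> B \<longrightarrow> A \<inter> B = {})"

definition join_atoms :: "('a \<Rightarrow> 'a) \<Rightarrow> 'a set set \<Rightarrow> nat \<Rightarrow> 'a set set" where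
  "join_atoms S P n = {C. C \<noteq> {} \<and> (\<exists>a. (\<forall>j\<le>n. a j \<in> P) \<and>
        C = {x. \<forall>j\<le>n. (S ^^ j) x \<in> a j})}"

definition part_entropy :: "'a measure \<Rightarrow> 'a set set \<Rightarrow> real" where
  "part_entropy M P = (\<Sum>A\<in>P. if measure M A = 0 then 0
       else - measure M A * log 2 (measure M A))"

definition ent_part :: "'a measure \<Rightarrow> ('a \<Rightarrow> 'a) \<Rightarrow> 'a set set \<Rightarrow> real" where
  "ent_part M S P = lim (\<lambda>n. part_entropy M (join_atoms S P n) / real (Suc n))"

definition ks_entropy :: "'a measure \<Rightarrow> ('a \<Rightarrow> 'a) \<Rightarrow> ereal" where
  "ks_entropy M S = (SUP P\<in>{P. fin_partition M P}. ereal (ent_part M S P))"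

definition measure_preserving_map :: "'a measure \<Rightarrow> ('a \<Rightarrow> 'a) \<Rightarrow> bool" where
  "measure_preserving_map M S \<longleftrightarrow> S \<in> M \<rightarrow>\<^sub>M M \<and>
     (\<forall>A\<in>sets M. emeasure M (S -` A \<inter> space M) = emeasure M A)"

definition ergodic_map :: "'a measure \<Rightarrow> ('a \<Rightarrow> 'a) \<Rightarrow> bool" where
  "ergodic_map M S \<longleftrightarrow> measure_preserving_map M S \<and>
     (\<forall>A\<in>sets M. S -` A \<inter> space M = A \<longrightarrow> emeasure M A = 0 \<or> emeasure M A = 1)"

definition lower_density :: "nat set \<Rightarrow> ereal" where
  "lower_density K = liminf (\<lambda>n. ereal (real (card (K \<inter> {1..n})) / real n))"

definition A_set :: "nat set \<Rightarrow> real \<Rightarrow> real set" where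
  "A_set K \<alpha> = closure ((\<lambda>k. frac (real k * \<alpha>)) ` K)"

end

theory Submission
  imports Defs "HOL-Analysis.Kronecker_Approximation_Theorem" "HOL-Real_Asymp.Real_Asymp"
begin

text \<open>
  Code the orbit of a generic \<open>x\<close> by its \<open>\<A>\<close>-itinerary and call a word of length \<open>n\<close> visible in a
  cell of a grid of \<open>q\<close> equal intervals if it occurs at some time \<open>k \<in> K\<close> with \<open>frac (k * \<alpha>)\<close> in that cell.
  If the visible words have measure at least \<open>2 powr (- n * \<delta>)\<close> in at least \<open>(\<epsilon> + \<delta>) * q\<close> cells, a greedy
  choice of about \<open>2 powr (n * \<delta>)\<close> words hits all but \<open>\<delta> * q\<close> of these, and letting \<open>q\<close> grow with the
  words fixed along a subsequence bounds the measure of the closure.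

  Otherwise, as the orbit of the rotation is equidistributed, at a set of times of density \<open>\<delta>\<close> the word read
  along the orbit lies in a set of measure below \<open>2 powr (- n * \<delta>)\<close> known from the cell alone, which shortens
  an optimal code of these words by \<open>n * \<delta>\<close> bits. The rotation has only \<open>q * m + 1\<close> patterns of \<open>m\<close> cells,
  so prescribing the cells is free in the limit, and concatenating \<open>m\<close> shortened block codes gives a code
  of words of length \<open>m * n\<close> beating the entropy once \<open>n\<close> is large.
\<close>

section \<open>Cells of an irrational rotation\<close>

text \<open>Count by disjoint translates: Kronecker approximation gives \<open>q - 1\<close> shifts
  \<open>t j\<close> that rotate by about \<open>j / (q - 1)\<close>, a spacing just above the cell
  width \<open>1 / q\<close>. The translates \<open>k + t j\<close> of the visits to one cell are
  then pairwise distinct and stay in \<open>{1..N + s}\<close>, so the visiting frequency is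
  asymptotically at most \<open>1 / (q - 1)\<close>.\<close>

lemma rotation_cell_count:
  fixes \<alpha> :: real
  assumes irr: "\<alpha> \<notin> \<rat>" and q: "q \<ge> (2::nat)"
  shows "\<exists>s::nat. \<forall>N i. (q - 1) * card {k\<in>{1..N}. \<lfloor>real q * frac (real k * \<alpha>)\<rfloor> = i} \<le> N + s"
proof -
  \<comment> \<open>Half of the surplus \<open>1 / (q - 1) - 1 / q\<close>: two approximation errors
    still leave gaps of at least a cell width.\<close>
  define \<eta> where "\<eta> = 1 / (2 * real q * (real q - 1))"
  have q1: "real q \<ge> 2" using q by simp
  have eta: "\<eta> > 0" unfolding \<eta>_def using q1 by simp
  have eta2: "1 / (real q - 1) - 2 * \<eta> = 1 / real q"
  proof -
    have "1 / (r - 1) - 2 * (1 / (2 * r * (r - 1))) = 1 / r" if "r \<ge> 2" for r :: real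
      using that by (simp add: divide_simps)
    then show ?thesis using q1 by (simp add: \<eta>_def)
  qed
  have "\<exists>k::nat. \<bar>frac (real k * \<alpha>) - real j / (real q - 1)\<bar> < \<eta>" if "j < q - 1" for j
  proof -
    have "0 \<le> real j / (real q - 1)" "real j / (real q - 1) \<le> 1"
      using that q1 by (auto simp: field_simps)
    then show ?thesis using Kronecker_approx_1_explicit[OF irr _ _ eta] by metis
  qed
  then obtain t :: "nat \<Rightarrow> nat" where
    t: "\<And>j. j < q - 1 \<Longrightarrow> \<bar>frac (real (t j) * \<alpha>) - real j / (real q - 1)\<bar> < \<eta>"
    by metis
  define s where "s = sum t {..<q - 1}"
  have ts: "t j \<le> s" if "j < q - 1" for j
    unfolding s_def using that by (intro member_le_sum) auto
  have disj: "k + t j \<noteq> k' + t j'"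
    if jj: "j < j'" "j' < q - 1"
      and c: "\<lfloor>real q * frac (real k * \<alpha>)\<rfloor> = i" "\<lfloor>real q * frac (real k' * \<alpha>)\<rfloor> = i" for k k' j j' i
  proof
    assume eq: "k + t j = k' + t j'"
    define d where "d = frac (real k * \<alpha>) - frac (real k' * \<alpha>)"
    define e where "e = frac (real (t j') * \<alpha>) - frac (real (t j) * \<alpha>)"
    have "\<bar>real q * frac (real k * \<alpha>) - real q * frac (real k' * \<alpha>)\<bar> < 1"
      using c by linarith
    then have "real q * \<bar>d\<bar> < 1"
      by (simp add: d_def abs_mult flip: right_diff_distrib)
    then have d: "\<bar>d\<bar> < 1 / real q" using q1 by (simp add: field_simps)
    have diff: "\<bar>e - (real j' - real j) / (real q - 1)\<bar> < 2 * \<eta>"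
      using t[of j] t[of j'] jj unfolding e_def by (simp add: diff_divide_distrib)
    have lo: "(real j' - real j) / (real q - 1) \<ge> 1 / (real q - 1)"
      using jj q1 by (intro divide_right_mono) auto
    have "(real j' - real j) / (real q - 1) \<le> (real q - 2) / (real q - 1)"
      using jj q1 by (intro divide_right_mono) auto
    also have "\<dots> = 1 - 1 / (real q - 1)" using q1 by (simp add: field_simps)
    finally have hi: "(real j' - real j) / (real q - 1) \<le> 1 - 1 / (real q - 1)" .
    \<comment> \<open>The upper bound guards against wrapping around the circle: \<open>e\<close> is
      farther than \<open>1 / q\<close> from every integer, whereas a collision would make
      \<open>e\<close> differ from an integer by \<open>d\<close>, of size below
      \<open>1 / q\<close>.\<close>
    have e: "1 / real q < e" "e < 1 - 1 / real q" using diff lo hi eta2 by linarith+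
    have "(real k + real (t j)) * \<alpha> = (real k' + real (t j')) * \<alpha>"
      using eq by (metis of_nat_add)
    moreover define z where
      "z = \<lfloor>real k' * \<alpha>\<rfloor> + \<lfloor>real (t j') * \<alpha>\<rfloor> - \<lfloor>real k * \<alpha>\<rfloor> - \<lfloor>real (t j) * \<alpha>\<rfloor>"
    ultimately have "d - e = of_int z"
      unfolding d_def e_def z_def frac_def by (simp add: algebra_simps)
    moreover have "d - e < 0" "d - e > -1" using d e by linarith+
    ultimately have "of_int (-1) < (of_int z :: real)" "of_int z < (of_int 0 :: real)" by auto
    then show False unfolding of_int_less_iff by linarith
  qed
  have "(q - 1) * card {k\<in>{1..N}. \<lfloor>real q * frac (real k * \<alpha>)\<rfloor> = i} \<le> N + s" for N i
  proof -
    let ?A = "{k\<in>{1..N}. \<lfloor>real q * frac (real k * \<alpha>)\<rfloor> = i}"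
    have inj: "inj_on (\<lambda>(j,k). k + t j) ({..<q - 1} \<times> ?A)"
    proof (rule inj_onI, clarsimp)
      fix j k j' k' assume h: "j < q - Suc 0" "j' < q - Suc 0" "k + t j = k' + t j'"
         "\<lfloor>real q * frac (real k' * \<alpha>)\<rfloor> = \<lfloor>real q * frac (real k * \<alpha>)\<rfloor>"
      show "j = j' \<and> k = k'"
      proof (cases j j' rule: linorder_cases)
        case less
        then show ?thesis using disj[OF less _ h(4)[symmetric] refl] h by simp
      next
        case greater
        then show ?thesis using disj[OF greater _ h(4) refl] h by simp
      qed (use h in simp)
    qed
    have "(\<lambda>(j,k). k + t j) ` ({..<q - 1} \<times> ?A) \<subseteq> {1..N + s}"
      using ts by (force intro: add_mono)
    then have "card ({..<q - 1} \<times> ?A) \<le> card {1..N + s}"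
      using inj by (intro card_inj_on_le) auto
    then show ?thesis by (simp add: card_cartesian_product)
  qed
  then show ?thesis by blast
qed

lemma card_range_le_of_invariant:
  assumes "finite Z" "\<And>k. s k \<in> Z" "\<And>k k'. s k = s k' \<Longrightarrow> g k = g k'"
  shows "finite (range g)" "card (range g) \<le> card Z"
proof -
  define G where "G z = g (SOME k. s k = z)" for z
  have "g k = G (s k)" for k
    using someI[of "\<lambda>k'. s k' = s k" k] unfolding G_def by (intro assms(3)) simp
  then have "range g \<subseteq> G ` Z" using assms(2) by auto
  then show "finite (range g)" "card (range g) \<le> card Z"
    using assms(1) by (auto intro: finite_subset surj_card_le)
qed

text \<open>Writing \<open>u = frac (k \<alpha>)\<close>, all entries of a pattern are nondecreasing in \<open>u\<close> before reduction
  modulo \<open>q\<close>, so a pattern is determined by the sum of its unreduced entries.\<close>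

lemma rotation_patterns:
  fixes \<alpha> :: real and q m n :: nat
  assumes q: "q \<ge> 1"
  defines "\<Gamma> \<equiv> range (\<lambda>k. map (\<lambda>j. \<lfloor>real q * frac (real (k + j * n) * \<alpha>)\<rfloor>) [0..<m])"
  shows "finite \<Gamma>" "card \<Gamma> \<le> q * m + 1"
proof -
  define u where "u k = frac (real k * \<alpha>)" for k :: nat
  define v where "v k j = \<lfloor>real q * (u k + real (j * n) * \<alpha>)\<rfloor>" for k j :: nat
  define s where "s k = (\<Sum>j<m. v k j)" for k
  define s0 where "s0 = (\<Sum>j<m. \<lfloor>real q * (real (j * n) * \<alpha>)\<rfloor>)"
  have cell: "\<lfloor>real q * frac y\<rfloor> = \<lfloor>real q * y\<rfloor> mod int q" for y
  proof -
    have "real q * y = real q * frac y + of_int (int q * \<lfloor>y\<rfloor>)" 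
      by (simp add: frac_def algebra_simps)
    then have *: "\<lfloor>real q * y\<rfloor> = \<lfloor>real q * frac y\<rfloor> + int q * \<lfloor>y\<rfloor>"
      by (metis floor_add_int)
    have "0 \<le> \<lfloor>real q * frac y\<rfloor>" by simp
    moreover have "\<lfloor>real q * frac y\<rfloor> < int q"
      using q frac_lt_1[of y] by (simp add: floor_less_iff)
    ultimately show ?thesis using * by simp
  qed
  have cellv: "\<lfloor>real q * frac (real (k + j * n) * \<alpha>)\<rfloor> = v k j mod int q" for k j
  proof -
    have "real (k + j * n) * \<alpha> = u k + real (j * n) * \<alpha> + of_int \<lfloor>real k * \<alpha>\<rfloor>"
      by (simp add: u_def frac_def algebra_simps)
    then have "frac (real (k + j * n) * \<alpha>) = frac (u k + real (j * n) * \<alpha>)"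
      by (metis frac_add_of_int_right)
    then show ?thesis by (simp add: cell v_def)
  qed
  have u: "0 \<le> u k" "u k < 1" for k by (auto simp: u_def frac_lt_1)
  \<comment> \<open>Moving \<open>u k\<close> over \<open>[0, 1)\<close> raises each summand by at
    most \<open>q\<close> above its value at \<open>u = 0\<close>, so the sum takes at most
    \<open>q * m + 1\<close> integer values.\<close>
  have range_s: "s k \<in> {s0..s0 + int (q * m)}" for k
  proof -
    have "v k j \<ge> \<lfloor>real q * (real (j * n) * \<alpha>)\<rfloor>" for j
      unfolding v_def using u[of k] by (intro floor_mono mult_left_mono) auto
    moreover have "v k j \<le> \<lfloor>real q * (real (j * n) * \<alpha>)\<rfloor> + int q" for j
    proof -
      have "v k j \<le> \<lfloor>real q * (real (j * n) * \<alpha>) + of_int (int q)\<rfloor>"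
        unfolding v_def using u[of k] q by (intro floor_mono) (simp add: algebra_simps mult_left_le)
      then show ?thesis by simp
    qed
    ultimately have "s0 \<le> s k" "s k \<le> (\<Sum>j<m. \<lfloor>real q * (real (j * n) * \<alpha>)\<rfloor> + int q)"
      unfolding s_def s0_def by (auto intro: sum_mono)
    then show ?thesis by (simp add: s0_def sum.distrib mult.commute)
  qed
  have det: "map (\<lambda>j. \<lfloor>real q * frac (real (k + j * n) * \<alpha>)\<rfloor>) [0..<m] =
        map (\<lambda>j. \<lfloor>real q * frac (real (k' + j * n) * \<alpha>)\<rfloor>) [0..<m]"
    if eq: "s k = s k'" for k k'
  proof -
    \<comment> \<open>The order of \<open>u k\<close> and \<open>u k'\<close> makes the unreduced
      patterns comparable entrywise, and comparable integer tuples with equal sums coincide.\<close>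
    have *: "\<forall>j<m. v k j = v k' j" if "u k \<le> u k'" "s k = s k'" for k k'
    proof -
      have le: "v k j \<le> v k' j" for j
        unfolding v_def using that(1) by (intro floor_mono mult_left_mono) auto
      have "(\<Sum>j<m. v k' j - v k j) = 0" using that(2) by (simp add: s_def sum_subtractf)
      then show ?thesis using le by (subst (asm) sum_nonneg_eq_0_iff) auto
    qed
    have "\<forall>j<m. v k j = v k' j"
      using *[of k k'] *[of k' k] eq by (metis linear)
    then show ?thesis by (simp add: cellv del: of_nat_add of_nat_mult)
  qed
  have "card {s0..s0 + int (q * m)} = nat (int (q * m + 1))" by (simp add: algebra_simps)
  then have "card {s0..s0 + int (q * m)} = q * m + 1" by (simp only: nat_int)
  then show "card \<Gamma> \<le> q * m + 1"
    unfolding \<Gamma>_def using card_range_le_of_invariant(2)[of "{s0..s0 + int (q * m)}" s, OF _ range_s det]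
    by simp
  show "finite \<Gamma>"
    unfolding \<Gamma>_def by (rule card_range_le_of_invariant(1)[of "{s0..s0 + int (q * m)}" s, OF _ range_s det]) simp
qed

section \<open>Greedy covering by few points\<close>

text \<open>Averaging over \<open>v\<close> with weights \<open>p\<close> shows that some point lies
  in a fraction at least \<open>P\<close> of the sets still missed, so every further choice
  multiplies their number by at most \<open>1 - P\<close>.\<close>

lemma greedy_cover:
  fixes p :: "'v \<Rightarrow> real" and E :: "'i \<Rightarrow> 'v set"
  assumes fin: "finite V" "finite I" and p0: "\<And>v. v \<in> V \<Longrightarrow> p v \<ge> 0" and p1: "sum p V = 1"
    and E: "\<And>i. i \<in> I \<Longrightarrow> E i \<subseteq> V" "\<And>i. i \<in> I \<Longrightarrow> sum p (E i) \<ge> P" and P: "P \<le> 1"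
  shows "\<exists>M\<subseteq>V. card M \<le> m \<and> real (card {i\<in>I. E i \<inter> M = {}}) \<le> (1 - P) ^ m * real (card I)"
proof (induction m)
  case 0
  show ?case by (rule exI[of _ "{}"]) simp
next
  case (Suc m)
  then obtain M where M: "M \<subseteq> V" "card M \<le> m"
    and r: "real (card {i\<in>I. E i \<inter> M = {}}) \<le> (1 - P) ^ m * real (card I)" by blast
  define R where "R = {i\<in>I. E i \<inter> M = {}}"
  have finR: "finite R" "R \<subseteq> I" using fin by (auto simp: R_def)
  have "\<exists>v\<in>V. real (card {i\<in>R. v \<in> E i}) \<ge> P * real (card R)"
  proof (rule ccontr)
    assume "\<not> ?thesis"
    then have less: "\<And>v. v \<in> V \<Longrightarrow> real (card {i\<in>R. v \<in> E i}) < P * real (card R)" by force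
    have "P * real (card R) = (\<Sum>i\<in>R. P)" by simp
    also have "\<dots> \<le> (\<Sum>i\<in>R. sum p (E i))" using E finR by (intro sum_mono) auto
    also have "\<dots> = (\<Sum>i\<in>R. \<Sum>v\<in>V. if v \<in> E i then p v else 0)"
    proof (rule sum.cong[OF refl])
      fix i assume "i \<in> R"
      then have "V \<inter> E i = E i" using E(1) finR by blast
      then have "sum p (E i) = sum p (V \<inter> E i)" by simp
      then show "sum p (E i) = (\<Sum>v\<in>V. if v \<in> E i then p v else 0)"
        using fin by (simp add: sum.inter_restrict)
    qed
    also have "\<dots> = (\<Sum>v\<in>V. \<Sum>i\<in>R. if v \<in> E i then p v else 0)" by (rule sum.swap)
    also have "\<dots> = (\<Sum>v\<in>V. p v * real (card {i\<in>R. v \<in> E i}))"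
      using finR by (intro sum.cong[OF refl]) (simp add: sum.inter_filter[symmetric] mult.commute)
    also have "\<dots> < (\<Sum>v\<in>V. p v * (P * real (card R)))"
    proof (rule sum_strict_mono_ex1)
      obtain v where v: "v \<in> V" "p v \<noteq> 0"
        using p1 sum.neutral[of V p] zero_neq_one by (metis (full_types))
      then have "p v > 0" using p0[of v] by linarith
      then show "\<exists>v\<in>V. p v * real (card {i\<in>R. v \<in> E i}) < p v * (P * real (card R))"
        using v less by (intro bexI[of _ v] mult_strict_left_mono) auto
    qed (use fin p0 less_imp_le[OF less] in \<open>auto intro: mult_left_mono\<close>)
    also have "\<dots> = P * real (card R)" by (simp add: sum_distrib_right[symmetric] p1)
    finally show False by simp
  qed
  then obtain v where v: "v \<in> V" "real (card {i\<in>R. v \<in> E i}) \<ge> P * real (card R)" by blast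
  have eq: "{i\<in>I. E i \<inter> insert v M = {}} = R - {i\<in>R. v \<in> E i}" by (auto simp: R_def)
  have "real (card {i\<in>I. E i \<inter> insert v M = {}}) = real (card R) - real (card {i\<in>R. v \<in> E i})"
    unfolding eq using finR card_mono[of R "{i\<in>R. v \<in> E i}"]
    by (subst card_Diff_subset) (auto simp: of_nat_diff)
  also have "\<dots> \<le> (1 - P) * real (card R)" using v by (simp add: algebra_simps)
  also have "\<dots> \<le> (1 - P) * ((1 - P) ^ m * real (card I))"
    using r P unfolding R_def by (intro mult_left_mono) auto
  finally have "real (card {i\<in>I. E i \<inter> insert v M = {}}) \<le> (1 - P) ^ Suc m * real (card I)"
    by (simp add: mult.assoc)
  moreover have "card (insert v M) \<le> Suc m"
    using M card_insert_if[of M v] finite_subset[OF M(1) fin(1)] by simp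
  ultimately show ?case using M v by (intro exI[of _ "insert v M"]) auto
qed

section \<open>The ergodic theorem for sets\<close>

text \<open>The maximum of the partial Birkhoff sums with \<open>1, ..., n + 1\<close> terms, in a
  recursive form that directly compares time \<open>n + 1\<close> at \<open>x\<close> with time
  \<open>n\<close> at \<open>S x\<close>.\<close>

fun max_sum :: "('a \<Rightarrow> 'a) \<Rightarrow> ('a \<Rightarrow> real) \<Rightarrow> nat \<Rightarrow> 'a \<Rightarrow> real" where
  "max_sum S f 0 x = f x"
| "max_sum S f (Suc n) x = f x + max 0 (max_sum S f n (S x))"

lemma max_sum_Suc: "max_sum S f n x \<le> max_sum S f (Suc n) x"
proof (induction n arbitrary: x)
  case (Suc n)
  show ?case unfolding max_sum.simps(2)[of S f _ x] using Suc[of "S x"] by linarith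
qed simp

lemma mono_max_sum: "m \<le> n \<Longrightarrow> max_sum S f m x \<le> max_sum S f n x"
proof (induction rule: dec_induct)
  case (step n)
  then show ?case using max_sum_Suc[of S f n x] by linarith
qed simp

lemma birkhoff_sum_le_max_sum: "(\<Sum>k\<le>n. f ((S ^^ k) x)) \<le> max_sum S f n x"
proof (induction n arbitrary: x)
  case (Suc n)
  have "(\<Sum>k\<le>Suc n. f ((S ^^ k) x)) = f x + (\<Sum>k\<le>n. f ((S ^^ k) (S x)))"
    by (subst sum.atMost_Suc_shift) (simp add: funpow_swap1)
  then show ?case using Suc[of "S x"] by simp
qed simp

lemma measurable_max_sum:
  assumes "S \<in> M \<rightarrow>\<^sub>M M" "f \<in> borel_measurable M"
  shows "max_sum S f n \<in> borel_measurable M"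
proof (induction n)
  case 0
  have "max_sum S f 0 = f" by auto
  then show ?case using assms by simp
next
  case (Suc n)
  have "max_sum S f (Suc n) = (\<lambda>x. f x + max 0 (max_sum S f n (S x)))" by auto
  then show ?case using assms Suc by (simp add: measurable_compose[OF assms(1) Suc])
qed

lemma abs_max_sum_le:
  assumes "\<And>x. \<bar>f x\<bar> \<le> B"
  shows "\<bar>max_sum S f n x\<bar> \<le> B * real (Suc n)"
proof (induction n arbitrary: x)
  case 0
  then show ?case using assms by simp
next
  case (Suc n)
  show ?case using Suc[of "S x"] assms[of x] by (simp add: algebra_simps max_def abs_if split: if_splits)
qed

context prob_space
begin

lemma distr_measure_preserving:
  assumes "measure_preserving_map M S"
  shows "distr M M S = M"
  using assms unfolding measure_preserving_map_def by (intro measure_eqI) (auto simp: emeasure_distr)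

lemma integral_measure_preserving:
  fixes g :: "'a \<Rightarrow> real"
  assumes "measure_preserving_map M S" "g \<in> borel_measurable M"
  shows "(\<integral>x. g (S x) \<partial>M) = (\<integral>x. g x \<partial>M)"
  using integral_distr[of S M M g] assms distr_measure_preserving[OF assms(1)]
  by (simp add: measure_preserving_map_def)

text \<open>If the maximal sums were unbounded almost everywhere, then the function
  \<open>F (n+1) - F n \<circ> S = f + max 0 (- F n \<circ> S)\<close>, whose integral is nonnegative, would tend to \<open>f\<close>.\<close>

lemma ergodic_max_sum_bounded:
  fixes f :: "'a \<Rightarrow> real"
  assumes erg: "ergodic_map M S" and f: "f \<in> borel_measurable M" and B: "\<And>x. \<bar>f x\<bar> \<le> B"
    and neg: "(\<integral>x. f x \<partial>M) < 0"
  shows "AE x in M. \<exists>b. \<forall>n. (\<Sum>k\<le>n. f ((S ^^ k) x)) \<le> b"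
proof -
  have mp: "measure_preserving_map M S" using erg by (simp add: ergodic_map_def)
  then have S: "S \<in> M \<rightarrow>\<^sub>M M" by (simp add: measure_preserving_map_def)
  define F where "F = max_sum S f"
  have [measurable]: "F n \<in> borel_measurable M" for n
    unfolding F_def by (rule measurable_max_sum[OF S f])
  note [measurable] = S f
  have FS [measurable]: "(\<lambda>x. F n (S x)) \<in> borel_measurable M" for n
    by measurable
  \<comment> \<open>The set where the maximal sums are unbounded. It is invariant, because
    \<open>F (Suc n) x\<close> and \<open>max 0 (F n (S x))\<close> differ by the number
    \<open>f x\<close>, independent of \<open>n\<close>; so ergodicity leaves only measure 0 or
    1.\<close>
  define D where "D = {x\<in>space M. \<forall>b::nat. \<exists>n. F n x > real b}"
  have D: "D \<in> sets M" unfolding D_def by measurable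
  have unb: "(\<forall>b::nat. \<exists>n. F n x > real b) \<longleftrightarrow> (\<forall>b::nat. \<exists>n. F n (S x) > real b)" for x
  proof
    assume l: "\<forall>b::nat. \<exists>n. F n x > real b"
    show "\<forall>b::nat. \<exists>n. F n (S x) > real b"
    proof
      fix b :: nat
      obtain c :: nat where c: "real c \<ge> b + \<bar>f x\<bar>" using real_arch_simple by blast
      obtain n where n: "F n x > real c" using l by blast
      then have "F (Suc n) x > real c" using max_sum_Suc[of S f n x] by (simp add: F_def)
      then have "F n (S x) > real b" using c by (auto simp: F_def)
      then show "\<exists>n. F n (S x) > real b" by blast
    qed
  next
    assume r: "\<forall>b::nat. \<exists>n. F n (S x) > real b"
    show "\<forall>b::nat. \<exists>n. F n x > real b"
    proof
      fix b :: nat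
      obtain c :: nat where c: "real c \<ge> b + \<bar>f x\<bar>" using real_arch_simple by blast
      obtain n where n: "F n (S x) > real c" using r by blast
      then have "F (Suc n) x > real b" using c by (auto simp: F_def)
      then show "\<exists>n. F n x > real b" by blast
    qed
  qed
  have "S -` D \<inter> space M = D"
    using unb measurable_space[OF S] unfolding D_def by auto
  then have D01: "emeasure M D = 0 \<or> emeasure M D = 1" using erg D by (auto simp: ergodic_map_def)
  have "emeasure M D \<noteq> 1"
  proof
    assume "emeasure M D = 1"
    then have "AE x in M. x \<in> D"
      using D by (simp add: AE_in_set_eq_1 measure_def)
    then have AED: "AE x in M. \<forall>b::nat. \<exists>n. F n (S x) > real b"
      by eventually_elim (use unb in \<open>auto simp: D_def\<close>)
    have Bn: "0 \<le> B" using B[of undefined] by linarith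
    have Fb: "\<bar>F n x\<bar> \<le> B * real (Suc n)" for n x
      unfolding F_def by (rule abs_max_sum_le[OF B])
    have intF: "integrable M (F n)" "integrable M (\<lambda>x. F n (S x))" for n
      by (rule integrable_const_bound[of _ "B * real (Suc n)"]; use Fb in simp)+
    define g where "g n x = F (Suc n) x - F n (S x)" for n x
    have gint: "(\<integral>x. g n x \<partial>M) \<ge> 0" for n
    proof -
      have "(\<integral>x. g n x \<partial>M) = (\<integral>x. F (Suc n) x \<partial>M) - (\<integral>x. F n x \<partial>M)"
        unfolding g_def using intF by (simp add: integral_measure_preserving[OF mp])
      moreover have "(\<integral>x. F n x \<partial>M) \<le> (\<integral>x. F (Suc n) x \<partial>M)"
        using intF by (intro integral_mono) (auto simp: F_def max_sum_Suc simp del: max_sum.simps)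
      ultimately show ?thesis by simp
    qed
    have geq: "g n x = f x + max 0 (- F n (S x))" for n x
      by (auto simp: g_def F_def)
    \<comment> \<open>If \<open>D\<close> had full measure, \<open>F n (S x)\<close> would become
      positive for almost every \<open>x\<close>, after which \<open>g n x = f x\<close>. The
      correction term is at most \<open>B\<close> because \<open>F n (S x) \<ge> f (S x)\<close>, so
      dominated convergence applies.\<close>
    have "(\<lambda>n. \<integral>x. g n x \<partial>M) \<longlonglongrightarrow> (\<integral>x. f x \<partial>M)"
    proof (rule integral_dominated_convergence[where w = "\<lambda>_. 2 * B"])
      show "AE x in M. (\<lambda>n. g n x) \<longlonglongrightarrow> f x"
        using AED
      proof eventually_elim
        case (elim x)
        then obtain n0 where n0: "F n0 (S x) > 0" by (metis of_nat_0)
        have "\<forall>n\<ge>n0. g n x = f x"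
          using n0 mono_max_sum[of n0 _ S f "S x"] by (fastforce simp: geq F_def)
        then show ?case by (intro tendsto_eventually eventually_sequentiallyI) auto
      qed
      show "AE x in M. norm (g n x) \<le> 2 * B" for n
      proof (rule AE_I2)
        fix x
        have "f (S x) \<le> F n (S x)" using mono_max_sum[of 0 n S f "S x"] by (simp add: F_def)
        then show "norm (g n x) \<le> 2 * B"
          using B[of x] B[of "S x"] by (simp add: geq)
      qed
      show "g n \<in> borel_measurable M" for n unfolding g_def by measurable
    qed simp_all
    then have "(\<integral>x. f x \<partial>M) \<ge> 0"
      by (rule LIMSEQ_le_const) (use gint in auto)
    then show False using neg by simp
  qed
  then have "AE x in M. x \<notin> D" using D01 D by (auto intro: AE_not_in simp: null_sets_def)
  then show ?thesis
    using AE_space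
  proof eventually_elim
    case (elim x)
    then obtain b :: nat where "\<forall>n. F n x \<le> real b" by (force simp: D_def not_less)
    moreover have "(\<Sum>k\<le>n. f ((S ^^ k) x)) \<le> F n x" for n
      unfolding F_def by (rule birkhoff_sum_le_max_sum)
    ultimately show ?case by (meson order_trans)
  qed
qed

text \<open>Subtract from the indicator of \<open>E\<close> a constant slightly above
  \<open>measure M E\<close>. The mean becomes negative, so the Birkhoff sums are bounded above
  almost everywhere, and the frequency cannot stay above that constant by a fixed amount.\<close>

lemma ergodic_upper_frequency:
  assumes erg: "ergodic_map M S" and E: "E \<in> sets M"
  shows "AE x in M. \<forall>\<eta>>0. \<forall>\<^sub>F N in sequentially.
      real (card {k\<in>{1..N}. (S ^^ k) x \<in> E}) \<le> (measure M E + \<eta>) * real N"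
proof -
  \<comment> \<open>The countable family of margins \<open>1 / (j + 1)\<close> lets a single null
    set serve every \<eta>.\<close>
  have "AE x in M. \<forall>j::nat. \<exists>b. \<forall>n. (\<Sum>k\<le>n. indicator E ((S ^^ k) x) - (measure M E + 1 / real (Suc j))) \<le> b"
  proof (subst AE_all_countable, intro allI ergodic_max_sum_bounded[OF erg])
    fix j :: nat
    show "(\<integral>x. indicator E x - (measure M E + 1 / real (Suc j)) \<partial>M) < 0"
      using E by (subst Bochner_Integration.integral_diff) (auto simp: prob_space emeasure_eq_measure)
    show "\<bar>indicator E x - (measure M E + 1 / real (Suc j))\<bar> \<le> 3" for x
    proof -
      have "0 \<le> measure M E" "measure M E \<le> 1" "0 \<le> 1 / real (Suc j)" "1 / real (Suc j) \<le> 1" by auto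
      then have "\<bar>1 - (measure M E + 1 / real (Suc j))\<bar> \<le> 3" "\<bar>0 - (measure M E + 1 / real (Suc j))\<bar> \<le> 3"
        by linarith+
      then show ?thesis by (cases "x \<in> E") (simp_all del: of_nat_Suc)
    qed
  qed (use E in measurable)
  then show ?thesis
  proof eventually_elim
    case (elim x)
    show ?case
    proof (intro allI impI)
      fix \<eta> :: real assume eta: "\<eta> > 0"
      obtain j :: nat where j: "1 / real (Suc j) < \<eta> / 2"
        using eta by (metis half_gt_zero nat_approx_posE)
      define a where "a = measure M E + 1 / real (Suc j)"
      obtain b where b: "\<And>n. (\<Sum>k\<le>n. indicator E ((S ^^ k) x) - a) \<le> b"
        using elim unfolding a_def by blast
      have le: "real (card {k\<in>{1..N}. (S ^^ k) x \<in> E}) \<le> b + a * real (Suc N)" for N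
      proof -
        have "real (card {k\<in>{1..N}. (S ^^ k) x \<in> E}) \<le> real (card {k\<in>{..N}. (S ^^ k) x \<in> E})"
          by (intro of_nat_mono card_mono) auto
        also have "\<dots> = (\<Sum>k\<le>N. indicator E ((S ^^ k) x))"
          by (simp add: indicator_def Int_def)
        finally show ?thesis using b[of N] by (simp add: sum_subtractf mult.commute)
      qed
      obtain N0 :: nat where N0: "real N0 \<ge> (b + a) / (\<eta> / 2)" using real_arch_simple by blast
      show "\<forall>\<^sub>F N in sequentially.
        real (card {k\<in>{1..N}. (S ^^ k) x \<in> E}) \<le> (measure M E + \<eta>) * real N"
      proof (rule eventually_sequentiallyI[of N0])
        fix N assume "N0 \<le> N"
        then have "real N \<ge> (b + a) / (\<eta> / 2)" using N0 by simp
        then have "b + a \<le> \<eta> / 2 * real N" using eta by (simp add: field_simps)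
        moreover have "a * real N \<le> (measure M E + \<eta> / 2) * real N"
          using j by (intro mult_right_mono) (auto simp: a_def)
        ultimately show "real (card {k\<in>{1..N}. (S ^^ k) x \<in> E}) \<le> (measure M E + \<eta>) * real N"
          using le[of N] by (simp add: algebra_simps)
      qed
    qed
  qed
qed

text \<open>The upper bound for the complement of \<open>E\<close> is the lower bound for
  \<open>E\<close>.\<close>

theorem ergodic_frequency:
  assumes erg: "ergodic_map M S" and E: "E \<in> sets M"
  shows "AE x in M. (\<lambda>N. real (card {k\<in>{1..N}. (S ^^ k) x \<in> E}) / real N) \<longlonglongrightarrow> measure M E"
proof -
  have E': "space M - E \<in> sets M" using E by simp
  have S: "S \<in> M \<rightarrow>\<^sub>M M"
    using erg by (simp add: ergodic_map_def measure_preserving_map_def)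
  show ?thesis
    using ergodic_upper_frequency[OF erg E] ergodic_upper_frequency[OF erg E'] AE_space
  proof eventually_elim
    case (elim x)
    have "(S ^^ k) x \<in> space M" for k
      using elim(3) measurable_space[OF S] by (induction k) auto
    then have split: "{1..N} = {k\<in>{1..N}. (S ^^ k) x \<in> E} \<union> {k\<in>{1..N}. (S ^^ k) x \<in> space M - E}" for N
      by auto
    have cnt: "N = card {k\<in>{1..N}. (S ^^ k) x \<in> E} + card {k\<in>{1..N}. (S ^^ k) x \<in> space M - E}" for N
    proof -
      have "N = card {1..N}" by simp
      also have "\<dots> = card {k\<in>{1..N}. (S ^^ k) x \<in> E} + card {k\<in>{1..N}. (S ^^ k) x \<in> space M - E}"
        by (subst split, rule card_Un_disjoint) auto
      finally show ?thesis .
    qed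
    have N: "real (card {k\<in>{1..N}. (S ^^ k) x \<in> E}) = real N - real (card {k\<in>{1..N}. (S ^^ k) x \<in> space M - E})" for N
      using cnt[of N] by linarith
    have mE: "measure M (space M - E) = 1 - measure M E" using E by (simp add: prob_compl)
    show ?case
    proof (rule tendstoI)
      fix e :: real assume e: "e > 0"
      have h: "e / 2 > 0" using e by simp
      show "\<forall>\<^sub>F N in sequentially. dist (real (card {k\<in>{1..N}. (S ^^ k) x \<in> E}) / real N) (measure M E) < e"
        using elim(1)[rule_format, OF h] elim(2)[rule_format, OF h] eventually_gt_at_top[of 0]
      proof eventually_elim
        case (elim n)
        let ?c = "real (card {k\<in>{1..n}. (S ^^ k) x \<in> E})"
        have n: "real n > 0" using elim(3) by simp
        have up: "?c / real n \<le> measure M E + e / 2" using elim(1) n by (simp add: pos_divide_le_eq)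
        have "?c \<ge> real n - (1 - measure M E + e / 2) * real n"
          using elim(2) N[of n] mE by simp
        then have "?c \<ge> (measure M E - e / 2) * real n" by (simp add: algebra_simps)
        then have "?c / real n \<ge> measure M E - e / 2" using n by (simp add: pos_le_divide_eq)
        then show ?case using up e by (simp add: dist_real_def abs_if)
      qed
    qed
  qed
qed

end

section \<open>Entropy along generic sequences\<close>

text \<open>The limsup of the Cesaro means of \<open>g\<close> is at most \<open>G\<close>, written
  as eventual linear bounds so that such estimates can be added.\<close>

definition upper_mean_le :: "(nat \<Rightarrow> real) \<Rightarrow> real \<Rightarrow> bool" where
  "upper_mean_le g G \<longleftrightarrow> (\<forall>\<eta>>0. \<forall>\<^sub>F N in sequentially. (\<Sum>k=1..N. g k) \<le> (G + \<eta>) * real N)"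

lemma upper_mean_le_add:
  assumes "upper_mean_le f F" "upper_mean_le g G"
  shows "upper_mean_le (\<lambda>k. f k + g k) (F + G)"
  unfolding upper_mean_le_def
proof (intro allI impI)
  fix \<eta> :: real assume "\<eta> > 0"
  then have h: "\<eta> / 2 > 0" by simp
  show "\<forall>\<^sub>F N in sequentially. (\<Sum>k=1..N. f k + g k) \<le> (F + G + \<eta>) * real N"
    using assms(1)[unfolded upper_mean_le_def, rule_format, OF h]
      assms(2)[unfolded upper_mean_le_def, rule_format, OF h]
  proof eventually_elim
    case (elim N)
    have "(F + \<eta> / 2) * real N + (G + \<eta> / 2) * real N = (F + G + \<eta>) * real N"
      by (simp add: field_simps)
    then show ?case using elim by (simp add: sum.distrib)
  qed
qed

lemma upper_mean_le_const: "upper_mean_le (\<lambda>_. c) c"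
  unfolding upper_mean_le_def by (auto simp: algebra_simps)

lemma upper_mean_le_sum:
  assumes "\<And>j. j < m \<Longrightarrow> upper_mean_le (f j) F"
  shows "upper_mean_le (\<lambda>k. \<Sum>j<m. f j k) (real m * F)"
  using assms
proof (induction m)
  case 0
  then show ?case using upper_mean_le_const[of 0] by simp
next
  case (Suc m)
  then have "upper_mean_le (\<lambda>k. (\<Sum>j<m. f j k) + f m k) (real m * F + F)"
    by (intro upper_mean_le_add) auto
  then show ?case by (simp add: algebra_simps)
qed

lemma upper_mean_le_shift:
  assumes "upper_mean_le f F"
  shows "upper_mean_le (\<lambda>k. f (k + s)) F"
  unfolding upper_mean_le_def
proof (intro allI impI)
  fix \<eta> :: real assume "\<eta> > 0"
  then have h: "\<eta> / 2 > 0" by simp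
  define c where "c = (F + \<eta> / 2) * real s - (\<Sum>k=1..s. f k)"
  obtain N0 :: nat where N0: "real N0 \<ge> c / (\<eta> / 2)" using real_arch_simple by blast
  have "\<forall>\<^sub>F N in sequentially. (\<Sum>k=1..N + s. f k) \<le> (F + \<eta> / 2) * real (N + s)"
    using assms[unfolded upper_mean_le_def, rule_format, OF h]
    by (subst eventually_sequentially_seg)
  then show "\<forall>\<^sub>F N in sequentially. (\<Sum>k=1..N. f (k + s)) \<le> (F + \<eta>) * real N"
    using eventually_ge_at_top[of N0]
  proof eventually_elim
    case (elim N)
    have un: "{1..N + s} = {1..s} \<union> {1 + s..N + s}" by auto
    have "(\<Sum>k=1..N + s. f k) = (\<Sum>k=1..s. f k) + (\<Sum>k=1 + s..N + s. f k)"
      unfolding un by (rule sum.union_disjoint) auto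
    also have "(\<Sum>k=1 + s..N + s. f k) = (\<Sum>k=1..N. f (k + s))"
      by (rule sum.shift_bounds_cl_nat_ivl)
    finally have "(\<Sum>k=1..N. f (k + s)) \<le> (F + \<eta> / 2) * real N + c"
      using elim(1) by (simp add: c_def algebra_simps add_divide_distrib)
    moreover have "c \<le> \<eta> / 2 * real N"
    proof -
      have "c / (\<eta> / 2) \<le> real N" using N0 elim(2) by simp
      then show ?thesis using h by (simp add: field_simps)
    qed
    moreover have "(F + \<eta>) * real N = (F + \<eta> / 2) * real N + \<eta> / 2 * real N"
      by (simp add: field_simps)
    ultimately show ?case by linarith
  qed
qed

lemma upper_mean_le_of_tendsto:
  assumes "(\<lambda>N. (\<Sum>k=1..N. f k) / real N) \<longlonglongrightarrow> F"
  shows "upper_mean_le f F"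
  unfolding upper_mean_le_def
proof (intro allI impI)
  fix \<eta> :: real assume "\<eta> > 0"
  then have "\<forall>\<^sub>F N in sequentially. (\<Sum>k=1..N. f k) / real N < F + \<eta>"
    by (intro order_tendstoD(2)[OF assms]) simp
  then show "\<forall>\<^sub>F N in sequentially. (\<Sum>k=1..N. f k) \<le> (F + \<eta>) * real N"
    using eventually_gt_at_top[of 0]
    by eventually_elim (simp add: pos_divide_less_eq)
qed

text \<open>Fekete's argument: with \<open>h\<close> the infimum of \<open>H k / k\<close>, division
  with remainder by a near-optimal \<open>a\<close> gives
  \<open>H n \<le> (h + \<eta> / 2) * n + R\<close>, while \<open>H (m * n) / m \<ge> h * n\<close>.
  The threshold is independent of \<open>m\<close>, so \<open>m\<close> can later tend to infinity
  with \<open>n\<close> fixed.\<close>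

lemma subadditive_almost_homogeneous:
  fixes H :: "nat \<Rightarrow> real"
  assumes sub: "\<And>a b. H (a + b) \<le> H a + H b" and nn: "\<And>n. H n \<ge> 0" and eta: "\<eta> > 0"
  shows "\<exists>n0. \<forall>n\<ge>n0. \<forall>m\<ge>1. H n \<le> H (m * n) / real m + \<eta> * real n"
proof -
  define h where "h = (INF k\<in>{1..}. H k / real k)"
  have bdd: "bdd_below ((\<lambda>k. H k / real k) ` {1..})"
    using nn by (intro bdd_belowI[of _ 0]) auto
  have h_le: "h \<le> H k / real k" if "k \<ge> 1" for k
    unfolding h_def using that by (intro cINF_lower[OF bdd]) auto
  have "\<exists>a\<in>{1..}. H a / real a < h + \<eta> / 2"
    using eta cINF_less_iff[OF _ bdd, of "h + \<eta> / 2"] by (simp add: h_def)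
  then obtain a :: nat where a: "a \<ge> 1" "H a / real a < h + \<eta> / 2" by auto
  define R where "R = (\<Sum>r<a. H r)"
  have H_mult: "H (d * a + r) \<le> real d * H a + H r" for d r
  proof (induction d)
    case (Suc d)
    have "H (Suc d * a + r) \<le> H a + H (d * a + r)" using sub[of a "d * a + r"] by (simp add: algebra_simps)
    then show ?case using Suc by (simp add: algebra_simps)
  qed simp
  have H_le: "H n \<le> (h + \<eta> / 2) * real n + R" for n
  proof -
    have r: "n mod a < a" using a by simp
    have "H n \<le> real (n div a) * H a + H (n mod a)" using H_mult[of "n div a" "n mod a"] by simp
    moreover have "H (n mod a) \<le> R" unfolding R_def using r nn by (intro member_le_sum) auto
    moreover have "real (n div a) * H a \<le> (h + \<eta> / 2) * real n"
    proof -
      have "real (n div a) * H a \<le> (real n / real a) * H a"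
        using nn of_nat_div_le_of_nat[of n a, where ?'a = real] by (intro mult_right_mono) auto
      also have "\<dots> = (H a / real a) * real n" by simp
      also have "\<dots> \<le> (h + \<eta> / 2) * real n" using a by (intro mult_right_mono) auto
      finally show ?thesis .
    qed
    ultimately show ?thesis by linarith
  qed
  obtain n1 :: nat where n1: "real n1 \<ge> R / (\<eta> / 2)" using real_arch_simple by blast
  have "H n \<le> H (m * n) / real m + \<eta> * real n" if n: "n \<ge> max 1 n1" and m: "m \<ge> 1" for n m
  proof -
    have "R / (\<eta> / 2) \<le> real n" using n1 n by simp
    then have R: "R \<le> \<eta> / 2 * real n" using eta by (simp add: field_simps)
    have "m * n \<ge> 1" using n m by (simp add: Suc_le_eq)
    then have "h * real n \<le> H (m * n) / real (m * n) * real n"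
      by (intro mult_right_mono h_le) auto
    also have "\<dots> = H (m * n) / real m" using n by simp
    finally show ?thesis using H_le[of n] R by (simp add: algebra_simps)
  qed
  then show ?thesis by blast
qed

section \<open>Words and product weights on blocks\<close>

definition word :: "(nat \<Rightarrow> 'b) \<Rightarrow> nat \<Rightarrow> nat \<Rightarrow> 'b list" where
  "word \<omega> k n = map (\<lambda>j. \<omega> (k + j)) [0..<n]"

definition words :: "'b set \<Rightarrow> nat \<Rightarrow> 'b list set" where
  "words B n = {v. set v \<subseteq> B \<and> length v = n}"

definition block_entropy :: "'b set \<Rightarrow> ('b list \<Rightarrow> real) \<Rightarrow> nat \<Rightarrow> real" where
  "block_entropy B p n = (\<Sum>v\<in>words B n. p v * (- ln (p v)))"

lemma length_word [simp]: "length (word \<omega> k n) = n"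
  by (simp add: word_def)

lemma word_append: "word \<omega> k (a + b) = word \<omega> k a @ word \<omega> (k + a) b"
proof -
  have "[0..<a + b] = [0..<a] @ map (\<lambda>j. j + a) [0..<b]"
    by (metis add.commute le0 map_add_upt upt_add_eq_append)
  then show ?thesis by (simp add: word_def comp_def ac_simps)
qed

lemma finite_words: "finite B \<Longrightarrow> finite (words B n)"
  unfolding words_def by (rule finite_lists_length_eq)

lemma sum_words_append:
  fixes f g :: "'b list \<Rightarrow> real"
  assumes "finite B"
  shows "(\<Sum>w\<in>words B (a + b). f (take a w) * g (drop a w)) = (\<Sum>v\<in>words B a. f v) * (\<Sum>v\<in>words B b. g v)"
proof -
  have bij: "bij_betw (\<lambda>(u, v). u @ v) (words B a \<times> words B b) (words B (a + b))"
    unfolding bij_betw_def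
  proof
    show "inj_on (\<lambda>(u, v). u @ v) (words B a \<times> words B b)"
      by (auto simp: inj_on_def words_def)
    show "(\<lambda>(u, v). u @ v) ` (words B a \<times> words B b) = words B (a + b)"
    proof (intro equalityI subsetI)
      fix w assume "w \<in> words B (a + b)"
      then have "take a w \<in> words B a" "drop a w \<in> words B b"
        by (auto simp: words_def dest: in_set_takeD in_set_dropD)
      then show "w \<in> (\<lambda>(u, v). u @ v) ` (words B a \<times> words B b)"
        by (intro image_eqI[of _ _ "(take a w, drop a w)"]) auto
    qed (auto simp: words_def)
  qed
  have "(\<Sum>w\<in>words B (a + b). f (take a w) * g (drop a w)) =
      (\<Sum>z\<in>words B a \<times> words B b. f (take a (case z of (u, v) \<Rightarrow> u @ v)) * g (drop a (case z of (u, v) \<Rightarrow> u @ v)))"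
    by (rule sum.reindex_bij_betw[OF bij, symmetric])
  also have "\<dots> = (\<Sum>(u, v)\<in>words B a \<times> words B b. f u * g v)"
    by (rule sum.cong) (auto simp: words_def)
  also have "\<dots> = (\<Sum>v\<in>words B a. f v) * (\<Sum>v\<in>words B b. g v)"
    by (simp add: sum_product sum.cartesian_product)
  finally show ?thesis .
qed

text \<open>The weight of \<open>w\<close> when its consecutive blocks of length \<open>n\<close>
  are coded independently, the \<open>j\<close>-th one by \<open>Q\<close> with the
  \<open>j\<close>-th side letter; code lengths of the blocks add up under the logarithm.\<close>

fun block_product :: "nat \<Rightarrow> ('c \<Rightarrow> 'b list \<Rightarrow> real) \<Rightarrow> 'c list \<Rightarrow> 'b list \<Rightarrow> real" where
  "block_product n Q [] w = 1"
| "block_product n Q (c # cs) w = Q c (take n w) * block_product n Q cs (drop n w)"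

lemma block_product_nonneg:
  "(\<And>c v. Q c v \<ge> 0) \<Longrightarrow> block_product n Q cs w \<ge> 0"
  by (induction cs arbitrary: w) auto

lemma sum_block_product_le_1:
  assumes "finite B" "\<And>c v. Q c v \<ge> 0" "\<And>c. (\<Sum>v\<in>words B n. Q c v) \<le> 1"
  shows "(\<Sum>w\<in>words B (length cs * n). block_product n Q cs w) \<le> 1"
proof (induction cs)
  case Nil
  have "words B 0 = {[]}" by (auto simp: words_def)
  then show ?case by simp
next
  case (Cons c cs)
  have "(\<Sum>w\<in>words B (length (c # cs) * n). block_product n Q (c # cs) w) =
     (\<Sum>v\<in>words B n. Q c v) * (\<Sum>w\<in>words B (length cs * n). block_product n Q cs w)"
    using sum_words_append[OF assms(1), of "Q c" n "block_product n Q cs" "length cs * n"] by simp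
  also have "\<dots> \<le> 1 * 1"
    using assms Cons by (intro mult_mono) (auto intro: sum_nonneg block_product_nonneg)
  finally show ?case by simp
qed

lemma block_product_word:
  "block_product n Q (map (\<lambda>j. i (k + j * n)) [0..<m]) (word \<omega> k (m * n)) =
    (\<Prod>j<m. Q (i (k + j * n)) (word \<omega> (k + j * n) n))"
proof (induction m arbitrary: k)
  case (Suc m)
  have "map (\<lambda>j. i (k + j * n)) [0..<Suc m] = i k # map (\<lambda>j. i (k + n + j * n)) [0..<m]"
    by (simp add: upt_conv_Cons map_Suc_upt[symmetric] comp_def add.assoc del: upt_Suc map_Suc_upt)
  then have "block_product n Q (map (\<lambda>j. i (k + j * n)) [0..<Suc m]) (word \<omega> k (Suc m * n)) =
     Q (i k) (word \<omega> k n) * (\<Prod>j<m. Q (i (k + n + j * n)) (word \<omega> (k + n + j * n) n))"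
    by (simp add: word_append Suc del: upt_Suc)
  also have "\<dots> = (\<Prod>j<Suc m. Q (i (k + j * n)) (word \<omega> (k + j * n) n))"
    by (subst prod.lessThan_Suc_shift) (simp add: add.assoc)
  finally show ?case .
qed simp

section \<open>Entropy and codes along a single sequence\<close>

text \<open>Abstracts one generic orbit: word frequencies exist and equal \<open>p\<close>, and no
  word of weight 0 is ever read, which keeps \<open>- ln (p v)\<close> meaningful at every time.
  Different sequences can share the same \<open>p\<close>.\<close>

locale generic_sequence =
  fixes B :: "'b set" and \<omega> :: "nat \<Rightarrow> 'b" and p :: "'b list \<Rightarrow> real"
  assumes finite_alphabet: "finite B"
    and symbol: "\<omega> k \<in> B"
    and frequency: "(\<lambda>N. real (card {k\<in>{1..N}. word \<omega> k (length v) = v}) / real N) \<longlonglongrightarrow> p v"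
    and occurring_pos: "p (word \<omega> k n) > 0"
begin

lemma word_in_words: "word \<omega> k n \<in> words B n"
  using symbol by (auto simp: words_def word_def)

lemma p_nonneg: "p v \<ge> 0"
  by (rule LIMSEQ_le_const[OF frequency]) auto

text \<open>Group the times by the word read there; there are finitely many words of length
  \<open>n\<close>, so the limits of the frequencies may be summed.\<close>

lemma mean_tendsto:
  fixes \<phi> :: "'b list \<Rightarrow> real"
  shows "(\<lambda>N. (\<Sum>k=1..N. \<phi> (word \<omega> k n)) / real N) \<longlonglongrightarrow> (\<Sum>v\<in>words B n. p v * \<phi> v)"
proof -
  have "(\<Sum>k=1..N. \<phi> (word \<omega> k n)) / real N =
      (\<Sum>v\<in>words B n. real (card {k\<in>{1..N}. word \<omega> k (length v) = v}) / real N * \<phi> v)" for N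
  proof -
    have "(\<Sum>k=1..N. \<phi> (word \<omega> k n)) = (\<Sum>v\<in>words B n. \<Sum>k\<in>{k\<in>{1..N}. word \<omega> k n = v}. \<phi> (word \<omega> k n))"
      by (rule sum.group[symmetric]) (use word_in_words finite_words[OF finite_alphabet] in auto)
    also have "\<dots> = (\<Sum>v\<in>words B n. real (card {k\<in>{1..N}. word \<omega> k (length v) = v}) * \<phi> v)"
      by (rule sum.cong) (auto simp: words_def)
    finally show ?thesis by (simp add: sum_divide_distrib)
  qed
  then show ?thesis
    by (simp only:) (intro tendsto_sum tendsto_mult frequency tendsto_const)
qed

lemma sum_p: "(\<Sum>v\<in>words B n. p v) = 1"
proof -
  have "(\<lambda>N. (\<Sum>k=1..N. 1) / real N) \<longlonglongrightarrow> (\<Sum>v\<in>words B n. p v)"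
    using mean_tendsto[of "\<lambda>_. 1" n] by simp
  moreover have "(\<lambda>N. (\<Sum>k=1..N. 1) / real N) \<longlonglongrightarrow> 1"
    by (rule tendsto_eventually, rule eventually_sequentiallyI[of 1]) auto
  ultimately show ?thesis by (rule LIMSEQ_unique)
qed

lemma p_le_1: "v \<in> words B n \<Longrightarrow> p v \<le> 1"
  using member_le_sum[of v "words B n" p] p_nonneg finite_words[OF finite_alphabet] by (simp add: sum_p)

lemma block_entropy_nonneg: "block_entropy B p n \<ge> 0"
  unfolding block_entropy_def
proof (rule sum_nonneg)
  fix v assume "v \<in> words B n"
  then show "0 \<le> p v * - ln (p v)"
    using p_le_1[of v n] p_nonneg[of v] by (cases "p v = 0") (auto simp: mult_le_0_iff)
qed

lemma ex_occurrence:
  assumes "p v > 0"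
  shows "\<exists>k. word \<omega> k (length v) = v"
proof (rule ccontr)
  assume "\<not> ?thesis"
  then have "(\<lambda>N. 0) \<longlonglongrightarrow> p v" using frequency[of v] by simp
  then show False using assms LIMSEQ_unique[OF tendsto_const] by fastforce
qed

text \<open>Gibbs' inequality, with the cross entropy estimated along the sequence itself.\<close>

lemma block_entropy_le:
  assumes Q: "\<And>v. Q v \<ge> 0" "(\<Sum>v\<in>words B n. Q v) \<le> 1"
    and g: "\<And>k. Q (word \<omega> k n) \<ge> exp (- g k)" "upper_mean_le g G"
  shows "block_entropy B p n \<le> G"
proof -
  \<comment> \<open>This is \<open>ln x \<le> x - 1\<close> at \<open>x = Q v / p v\<close>,
    multiplied by \<open>p v\<close>. A word of positive weight occurs somewhere, so the lower bound
    \<open>exp (- g k)\<close> makes \<open>Q v\<close> positive; for weight 0 the claim is just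
    \<open>Q v \<ge> 0\<close>.\<close>
  have pt: "p v * (- ln (p v)) \<le> p v * (- ln (Q v)) + (Q v - p v)" if v: "v \<in> words B n" for v
  proof (cases "p v > 0")
    case True
    then obtain k where "word \<omega> k n = v" using ex_occurrence[of v] v by (auto simp: words_def)
    then have Qv: "Q v > 0" using g(1)[of k] by (metis exp_gt_zero less_le_trans)
    have "ln (Q v / p v) \<le> Q v / p v - 1" using True Qv by (intro ln_le_minus_one) simp
    then have "p v * (ln (Q v) - ln (p v)) \<le> p v * (Q v / p v - 1)"
      using True Qv by (intro mult_left_mono) (auto simp: ln_div)
    then show ?thesis using True by (simp add: algebra_simps)
  next
    case False
    then show ?thesis using p_nonneg[of v] Q(1)[of v] by simp
  qed
  have "block_entropy B p n \<le> (\<Sum>v\<in>words B n. p v * (- ln (Q v)) + (Q v - p v))"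
    unfolding block_entropy_def by (rule sum_mono[OF pt])
  also have "\<dots> \<le> (\<Sum>v\<in>words B n. p v * (- ln (Q v)))"
    using Q(2) sum_p[of n] by (simp only: sum.distrib sum_subtractf)
  \<comment> \<open>The cross entropy is the limit of the means of \<open>- ln Q\<close> along the
    sequence, and each of these terms is at most \<open>g k\<close>.\<close>
  also have "\<dots> \<le> G"
  proof (rule field_le_epsilon)
    fix \<eta> :: real assume eta: "\<eta> > 0"
    have "- ln (Q (word \<omega> k n)) \<le> g k" for k
      using g(1)[of k] by (metis exp_gt_zero exp_le_cancel_iff exp_ln less_le_trans minus_le_iff)
    then have le: "(\<Sum>k=1..N. - ln (Q (word \<omega> k n))) \<le> (\<Sum>k=1..N. g k)" for N
      by (rule sum_mono)
    have "\<forall>\<^sub>F N in sequentially. (\<Sum>k=1..N. - ln (Q (word \<omega> k n))) / real N \<le> G + \<eta>"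
      using g(2)[unfolded upper_mean_le_def, rule_format, OF eta] eventually_gt_at_top[of 0]
    proof eventually_elim
      case (elim N)
      then have "(\<Sum>k=1..N. - ln (Q (word \<omega> k n))) \<le> (G + \<eta>) * real N"
        using le[of N] by linarith
      then show ?case using elim(2) by (simp only: pos_divide_le_eq of_nat_0_less_iff)
    qed
    then show "(\<Sum>v\<in>words B n. p v * (- ln (Q v))) \<le> G + \<eta>"
      by (rule tendsto_upperbound[OF mean_tendsto[of "\<lambda>v. - ln (Q v)" n]]) simp
  qed
  finally show ?thesis .
qed

lemma upper_mean_information:
  "upper_mean_le (\<lambda>k. - ln (p (word \<omega> k n))) (block_entropy B p n)"
  unfolding block_entropy_def by (rule upper_mean_le_of_tendsto[OF mean_tendsto])

text \<open>Gibbs' inequality with the product of the weights of the two parts. The second part is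
  read at shifted times, and a shift does not change upper means.\<close>

lemma block_entropy_add_le:
  "block_entropy B p (a + b) \<le> block_entropy B p a + block_entropy B p b"
proof (rule block_entropy_le)
  show "(\<Sum>w\<in>words B (a + b). p (take a w) * p (drop a w)) \<le> 1"
    by (simp add: sum_words_append[OF finite_alphabet] sum_p)
  show "upper_mean_le (\<lambda>k. - ln (p (word \<omega> k a)) + - ln (p (word \<omega> (k + a) b)))
     (block_entropy B p a + block_entropy B p b)"
    by (intro upper_mean_le_add upper_mean_information
        upper_mean_le_shift[of "\<lambda>k. - ln (p (word \<omega> k b))"])
  show "exp (- (- ln (p (word \<omega> k a)) + - ln (p (word \<omega> (k + a) b))))
     \<le> p (take a (word \<omega> k (a + b))) * p (drop a (word \<omega> k (a + b)))" for k
    using occurring_pos[of k a] occurring_pos[of "k + a" b] by (simp add: word_append exp_add)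
qed (simp add: p_nonneg)

text \<open>A word of length \<open>m * n\<close> is coded by the mixture, over all patterns of the side information \<open>i\<close>,
  of the products of the block codes \<open>Q (i k)\<close>; identifying the pattern costs only \<open>ln c\<close>.\<close>

lemma block_entropy_le_mixture:
  fixes i :: "nat \<Rightarrow> 'c"
  defines "\<Gamma> m n \<equiv> range (\<lambda>k. map (\<lambda>j. i (k + j * n)) [0..<m])"
  assumes Q: "\<And>c v. Q c v \<ge> 0" "\<And>c. (\<Sum>v\<in>words B n. Q c v) \<le> 1"
    and f: "\<And>k. Q (i k) (word \<omega> k n) \<ge> exp (- f k)" "upper_mean_le f F"
    and \<Gamma>: "finite (\<Gamma> m n)" "real (card (\<Gamma> m n)) \<le> c"
  shows "block_entropy B p (m * n) \<le> ln c + real m * F"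
proof (rule block_entropy_le)
  have "\<Gamma> m n \<noteq> {}" by (simp add: \<Gamma>_def)
  then have "card (\<Gamma> m n) > 0" using \<Gamma> by (simp add: card_gt_0_iff)
  then have c: "c > 0" using \<Gamma> by linarith
  show "(\<Sum>\<gamma>\<in>\<Gamma> m n. block_product n Q \<gamma> w) / c \<ge> 0" for w
    using c Q by (intro divide_nonneg_nonneg sum_nonneg block_product_nonneg) auto
  have "(\<Sum>w\<in>words B (m * n). \<Sum>\<gamma>\<in>\<Gamma> m n. block_product n Q \<gamma> w) =
      (\<Sum>\<gamma>\<in>\<Gamma> m n. \<Sum>w\<in>words B (m * n). block_product n Q \<gamma> w)"
    by (rule sum.swap)
  also have "\<dots> \<le> (\<Sum>\<gamma>\<in>\<Gamma> m n. 1)"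
  proof (rule sum_mono)
    fix \<gamma> assume "\<gamma> \<in> \<Gamma> m n"
    then have "length \<gamma> = m" by (auto simp: \<Gamma>_def)
    then show "(\<Sum>w\<in>words B (m * n). block_product n Q \<gamma> w) \<le> 1"
      using sum_block_product_le_1[OF finite_alphabet, where Q = Q and n = n and cs = \<gamma>] Q by simp
  qed
  also have "\<dots> \<le> c" using \<Gamma> by simp
  finally show "(\<Sum>w\<in>words B (m * n). (\<Sum>\<gamma>\<in>\<Gamma> m n. block_product n Q \<gamma> w) / c) \<le> 1"
    using c by (simp add: sum_divide_distrib[symmetric])
  show "upper_mean_le (\<lambda>k. ln c + (\<Sum>j<m. f (k + j * n))) (ln c + real m * F)"
    by (intro upper_mean_le_add upper_mean_le_const upper_mean_le_sum upper_mean_le_shift f)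
  show "exp (- (ln c + (\<Sum>j<m. f (k + j * n)))) \<le> (\<Sum>\<gamma>\<in>\<Gamma> m n. block_product n Q \<gamma> (word \<omega> k (m * n))) / c" for k
  proof -
    let ?\<gamma> = "map (\<lambda>j. i (k + j * n)) [0..<m]"
    have "exp (- (\<Sum>j<m. f (k + j * n))) = (\<Prod>j<m. exp (- f (k + j * n)))"
      by (simp add: exp_sum sum_negf[symmetric])
    also have "\<dots> \<le> (\<Prod>j<m. Q (i (k + j * n)) (word \<omega> (k + j * n) n))"
      by (intro prod_mono) (use f in auto)
    also have "\<dots> = block_product n Q ?\<gamma> (word \<omega> k (m * n))" by (simp only: block_product_word)
    \<comment> \<open>The mixture dominates its summand for the pattern actually seen at time
      \<open>k\<close>; the division by \<open>c\<close> becomes the term \<open>ln c\<close> in the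
      code length.\<close>
    also have "\<dots> \<le> (\<Sum>\<gamma>\<in>\<Gamma> m n. block_product n Q \<gamma> (word \<omega> k (m * n)))"
      using \<Gamma> by (intro member_le_sum block_product_nonneg Q) (auto simp: \<Gamma>_def)
    finally show ?thesis
      using c by (simp add: exp_diff exp_minus field_simps exp_add)
  qed
qed

text \<open>At a time in \<open>J\<close> the side letter confines the word to
  \<open>E (i k)\<close>, of weight at most \<open>P\<close>, so conditioning \<open>p\<close> on
  that set saves \<open>- ln P\<close>. As the side letter does not reveal whether the time is in
  \<open>J\<close>, half of the weight goes to \<open>p\<close> itself and half to the conditioned
  weights, at a cost of \<open>ln 2\<close> per block.\<close>

lemma block_entropy_le_visible:
  fixes i :: "nat \<Rightarrow> 'c" and E :: "'c \<Rightarrow> 'b list set"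
  defines "\<Gamma> m n \<equiv> range (\<lambda>k. map (\<lambda>j. i (k + j * n)) [0..<m])"
  assumes E: "\<And>c. E c \<subseteq> words B n"
    and J: "\<And>k. k \<in> J \<Longrightarrow> word \<omega> k n \<in> E (i k)" "\<And>k. k \<in> J \<Longrightarrow> sum p (E (i k)) \<le> P"
    and P: "0 < P" "P \<le> 1"
    and dens: "\<forall>\<^sub>F N in sequentially. real (card (J \<inter> {1..N})) \<ge> \<delta> * real N"
    and \<Gamma>: "finite (\<Gamma> m n)" "real (card (\<Gamma> m n)) \<le> c"
  shows "block_entropy B p (m * n) \<le> ln c + real m * (ln 2 + block_entropy B p n + \<delta> * ln P)"
proof -
  \<comment> \<open>If \<open>E c\<close> has weight 0, the quotient is 0 by convention and the
    total mass is \<open>1 / 2\<close>, still at most 1.\<close>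
  define Q where "Q c v = p v / 2 * (1 + indicator (E c) v / sum p (E c))" for c v
  define f where "f k = ln 2 + - ln (p (word \<omega> k n)) + (if k \<in> J then ln P else 0)" for k
  have sE: "sum p (E c) \<ge> 0" for c by (simp add: p_nonneg sum_nonneg)
  have Q0: "Q c v \<ge> 0" for c v
    unfolding Q_def using sE[of c] by (intro mult_nonneg_nonneg) (auto simp: p_nonneg)
  have Q1: "(\<Sum>v\<in>words B n. Q c v) \<le> 1" for c
  proof -
    have "(\<Sum>v\<in>words B n. Q c v) = (\<Sum>v\<in>words B n. p v) / 2 + (\<Sum>v\<in>words B n. p v * indicator (E c) v) / (2 * sum p (E c))"
      unfolding Q_def sum_divide_distrib sum.distrib[symmetric]
      by (intro sum.cong refl) (simp add: algebra_simps)
    also have "(\<Sum>v\<in>words B n. p v * indicator (E c) v) = sum p (words B n \<inter> E c)"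
      using finite_words[OF finite_alphabet] by (simp add: sum.inter_restrict indicator_def if_distrib cong: if_cong)
    also have "words B n \<inter> E c = E c" using E by blast
    finally show ?thesis by (simp add: sum_p)
  qed
  have Qf: "Q (i k) (word \<omega> k n) \<ge> exp (- f k)" for k
  proof -
    let ?v = "word \<omega> k n"
    have pv: "p ?v > 0" by (rule occurring_pos)
    show ?thesis
    proof (cases "k \<in> J")
      case True
      have fin: "finite (E (i k))" using E finite_words[OF finite_alphabet] by (rule finite_subset)
      have "p ?v \<le> sum p (E (i k))"
        using J(1)[OF True] fin p_nonneg by (intro member_le_sum) auto
      then have "1 / P \<le> 1 / sum p (E (i k))"
        using pv J(2)[OF True] P by (intro divide_left_mono) auto
      then have "p ?v / 2 * (1 / P) \<le> Q (i k) ?v"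
        unfolding Q_def using J(1)[OF True] pv by (intro mult_left_mono) auto
      moreover have "exp (- f k) = p ?v / 2 * (1 / P)"
        using True pv P by (simp add: f_def exp_diff exp_minus exp_add field_simps)
      ultimately show ?thesis by simp
    next
      case False
      have "p ?v / 2 * 1 \<le> Q (i k) ?v"
        unfolding Q_def using pv sE[of "i k"] by (intro mult_left_mono) auto
      moreover have "exp (- f k) = p ?v / 2"
        using False pv by (simp add: f_def exp_diff exp_minus exp_add field_simps)
      ultimately show ?thesis by simp
    qed
  qed
  have "upper_mean_le (\<lambda>k. if k \<in> J then ln P else 0) (\<delta> * ln P)"
    unfolding upper_mean_le_def
  proof (intro allI impI)
    fix \<eta> :: real assume eta: "\<eta> > 0"
    show "\<forall>\<^sub>F N in sequentially. (\<Sum>k=1..N. if k \<in> J then ln P else 0) \<le> (\<delta> * ln P + \<eta>) * real N"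
      using dens
    proof eventually_elim
      case (elim N)
      have "(\<Sum>k=1..N. if k \<in> J then ln P else 0) = real (card (J \<inter> {1..N})) * ln P"
        by (simp add: sum.inter_restrict[symmetric] Int_commute)
      \<comment> \<open>Since \<open>ln P \<le> 0\<close>, a lower bound on the count of
        \<open>J\<close> bounds the sum from above.\<close>
      also have "\<dots> \<le> \<delta> * real N * ln P"
        using elim P by (intro mult_right_mono_neg) auto
      also have "\<dots> \<le> (\<delta> * ln P + \<eta>) * real N" using eta by (simp add: algebra_simps)
      finally show ?case .
    qed
  qed
  then have "upper_mean_le f (ln 2 + block_entropy B p n + \<delta> * ln P)"
    unfolding f_def by (intro upper_mean_le_add upper_mean_le_const upper_mean_information)
  then show ?thesis
    using block_entropy_le_mixture[where Q = Q and i = i and f = f, OF Q0 Q1 Qf] \<Gamma> unfolding \<Gamma>_def by blast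
qed

text \<open>Divide the estimate for words of length \<open>m * n\<close> by \<open>m\<close> and let
  \<open>m\<close> grow: the pattern cost, logarithmic in \<open>m\<close>, disappears, and
  \<open>hom\<close> makes \<open>block_entropy B p n\<close> appear on both sides and cancel. The
  mean saving \<open>\<delta> * - ln P\<close> per block thus cannot exceed the overhead
  \<open>ln 2\<close> plus the defect \<open>\<eta> * n\<close>.\<close>

lemma visible_density_le:
  fixes i :: "nat \<Rightarrow> 'c" and E :: "'c \<Rightarrow> 'b list set" and q :: nat
  defines "\<Gamma> m n \<equiv> range (\<lambda>k. map (\<lambda>j. i (k + j * n)) [0..<m])"
  assumes E: "\<And>c. E c \<subseteq> words B n"
    and J: "\<And>k. k \<in> J \<Longrightarrow> word \<omega> k n \<in> E (i k)" "\<And>k. k \<in> J \<Longrightarrow> sum p (E (i k)) \<le> P"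
    and P: "0 < P" "P \<le> 1"
    and dens: "\<forall>\<^sub>F N in sequentially. real (card (J \<inter> {1..N})) \<ge> \<delta> * real N"
    and \<Gamma>: "\<And>m. finite (\<Gamma> m n)" "\<And>m. card (\<Gamma> m n) \<le> q * m + 1"
    and hom: "\<And>m. m \<ge> 1 \<Longrightarrow> block_entropy B p n \<le> block_entropy B p (m * n) / real m + \<eta> * real n"
  shows "\<delta> * - ln P \<le> ln 2 + \<eta> * real n"
proof -
  define r where "r = real q + 1"
  have r: "r > 0" by (simp add: r_def)
  have "block_entropy B p n \<le> ln (r * real m + 1) / real m + (ln 2 + block_entropy B p n + \<delta> * ln P) + \<eta> * real n"
    if m: "m \<ge> 1" for m
  proof -
    have "real (card (\<Gamma> m n)) \<le> real (q * m + 1)" using \<Gamma>(2)[of m] by (rule of_nat_mono)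
    also have "\<dots> \<le> r * real m + 1" by (simp add: r_def algebra_simps)
    finally have "block_entropy B p (m * n) \<le> ln (r * real m + 1) + real m * (ln 2 + block_entropy B p n + \<delta> * ln P)"
      using \<Gamma>(1) unfolding \<Gamma>_def by (intro block_entropy_le_visible[where i = i and E = E and J = J, OF E J P dens]) auto
    then have "block_entropy B p (m * n) / real m \<le> (ln (r * real m + 1) + real m * (ln 2 + block_entropy B p n + \<delta> * ln P)) / real m"
      by (rule divide_right_mono) simp
    also have "\<dots> = ln (r * real m + 1) / real m + (ln 2 + block_entropy B p n + \<delta> * ln P)"
      using m by (simp add: add_divide_distrib)
    finally show ?thesis using hom[OF m] by linarith
  qed
  then have ev: "\<forall>\<^sub>F m in sequentially. ln (r * real m + 1) / real m \<ge> - (ln 2 + \<delta> * ln P + \<eta> * real n)"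
    by (intro eventually_sequentiallyI[of 1]) (smt (verit))
  have lim: "(\<lambda>m. ln (r * real m + 1) / real m) \<longlonglongrightarrow> 0"
    using r by real_asymp
  have "0 \<ge> - (ln 2 + \<delta> * ln P + \<eta> * real n)"
    by (rule tendsto_lowerbound[OF lim ev]) simp
  then show ?thesis by simp
qed

end

section \<open>Covering the circle by few words\<close>

text \<open>The closure is the decreasing intersection of the bounded neighbourhoods
  \<open>V n\<close>. As soon as \<open>q \<ge> n + 1\<close>, every hit cell lies inside
  \<open>V n\<close>, and for infinitely many \<open>q\<close> these cells have total length at
  least \<epsilon>; continuity from above carries the bound to the closure.\<close>

lemma emeasure_closure_ge_hit_cells:
  fixes T :: "real set"
  assumes T: "T \<subseteq> {0..<1}"
    and hit: "infinite {q::nat. real (card {i\<in>{0..<int q}. \<exists>t\<in>T. \<lfloor>real q * t\<rfloor> = i}) \<ge> \<epsilon> * real q}"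
  shows "emeasure lborel (closure T) \<ge> ennreal \<epsilon>"
proof -
  define V where "V n = (\<Union>t\<in>T. ball t (2 / real (Suc n)))" for n
  have clo: "closure T = (\<Inter>n. V n)"
  proof (intro equalityI subsetI)
    fix x assume x: "x \<in> closure T"
    show "x \<in> (\<Inter>n. V n)"
      unfolding V_def using x by (auto simp: closure_approachable simp del: of_nat_Suc)
  next
    fix x assume x: "x \<in> (\<Inter>n. V n)"
    show "x \<in> closure T"
      unfolding closure_approachable
    proof (intro allI impI)
      fix e :: real assume "e > 0"
      then obtain n where n: "1 / real (Suc n) < e / 2" by (metis half_gt_zero nat_approx_posE)
      obtain t where "t \<in> T" "dist t x < 2 / real (Suc n)" using x by (auto simp: V_def simp del: of_nat_Suc)
      then show "\<exists>t\<in>T. dist t x < e" using n by (intro bexI[of _ t]) (auto simp del: of_nat_Suc)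
    qed
  qed
  have openV: "open (V n)" for n unfolding V_def by blast
  have dec: "decseq V"
  proof (rule decseq_SucI)
    fix n
    have "2 / real (Suc (Suc n)) \<le> 2 / real (Suc n)" by (intro divide_left_mono) auto
    then show "V (Suc n) \<subseteq> V n" unfolding V_def by (intro UN_mono subset_ball) auto
  qed
  have Vb: "V n \<subseteq> {-2..3}" for n
  proof
    fix x assume "x \<in> V n"
    then obtain t where t: "t \<in> T" "dist t x < 2 / real (Suc n)" by (auto simp: V_def simp del: of_nat_Suc)
    have "2 / real (Suc n) \<le> 2" by (simp add: field_simps)
    then have "dist t x < 2" using t by linarith
    moreover have "0 \<le> t" "t < 1" using t T by auto
    ultimately show "x \<in> {-2..3}" by (auto simp: dist_real_def abs_less_iff)
  qed
  have fin: "emeasure lborel (V n) \<noteq> \<infinity>" for n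
  proof -
    have "emeasure lborel (V n) \<le> emeasure lborel {-2..3::real}"
      by (rule emeasure_mono[OF Vb]) simp
    also have "\<dots> < \<infinity>" by simp
    finally show ?thesis by simp
  qed
  have lim: "(\<lambda>n. emeasure lborel (V n)) \<longlonglongrightarrow> emeasure lborel (\<Inter>n. V n)"
    using dec fin openV by (intro Lim_emeasure_decseq) auto
  have ge: "ennreal \<epsilon> \<le> emeasure lborel (V n)" for n
  proof -
    obtain q where q: "q \<ge> Suc n"
      and c: "real (card {i\<in>{0..<int q}. \<exists>t\<in>T. \<lfloor>real q * t\<rfloor> = i}) \<ge> \<epsilon> * real q"
      using hit unfolding infinite_nat_iff_unbounded_le by blast
    define I where "I = {i\<in>{0..<int q}. \<exists>t\<in>T. \<lfloor>real q * t\<rfloor> = i}"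
    have finI: "finite I"
      unfolding I_def by (rule finite_subset[of _ "{0..<int q}"]) auto
    define Z where "Z i = {real_of_int i / real q..<(real_of_int i + 1) / real q}" for i
    have q0: "real q > 0" using q by simp
    have memZ: "y \<in> Z i \<longleftrightarrow> \<lfloor>real q * y\<rfloor> = i" for y i
      unfolding Z_def using q0 by (simp add: floor_eq_iff field_simps)
    have disj: "disjoint_family_on Z I"
      by (auto simp: disjoint_family_on_def memZ)
    have ZV: "Z i \<subseteq> V n" if "i \<in> I" for i
    proof
      fix y assume y: "y \<in> Z i"
      obtain t where t: "t \<in> T" "\<lfloor>real q * t\<rfloor> = i" using \<open>i \<in> I\<close> by (auto simp: I_def)
      have "\<bar>real q * t - real q * y\<bar> < 1" using t y memZ[of y i] by linarith
      then have "real q * \<bar>t - y\<bar> < 1" by (simp add: abs_mult flip: right_diff_distrib)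
      then have "dist t y < 1 / real q" using q0 by (simp add: dist_real_def field_simps)
      also have "\<dots> \<le> 2 / real (Suc n)" using q by (intro frac_le) auto
      finally show "y \<in> V n" using t by (auto simp: V_def simp del: of_nat_Suc)
    qed
    have emZ: "emeasure lborel (Z i) = ennreal (1 / real q)" for i
      using q0 by (simp add: Z_def emeasure_lborel_Ico divide_right_mono flip: diff_divide_distrib)
    have "ennreal \<epsilon> \<le> ennreal (real (card I) * (1 / real q))"
      using c q0 by (intro ennreal_leI) (simp add: I_def field_simps)
    also have "real (card I) * (1 / real q) = (\<Sum>i\<in>I. 1 / real q)" by simp
    also have "ennreal \<dots> = (\<Sum>i\<in>I. emeasure lborel (Z i))"
      unfolding emZ by (rule sum_ennreal[symmetric]) simp
    also have "\<dots> = emeasure lborel (\<Union>i\<in>I. Z i)"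
      by (rule sum_emeasure[OF _ disj finI]) (auto simp: Z_def)
    also have "\<dots> \<le> emeasure lborel (V n)"
      using ZV openV by (intro emeasure_mono) auto
    finally show ?thesis .
  qed
  show ?thesis
    unfolding clo by (rule LIMSEQ_le_const[OF lim]) (use ge in blast)
qed

text \<open>For \<open>P = exp (- L)\<close>, the hypothesis \<open>big\<close> is the negation of
  the conclusion of \<open>visible_density_le\<close>, so cells whose visible words weigh at most
  \<open>P\<close> cannot take up times of \<open>K\<close> of density \<delta>. The bound on
  \<open>card M\<close> is the number of greedy steps after which at most a fraction \<delta> of the
  other cells is missed.\<close>

lemma (in generic_sequence) few_words_cover:
  fixes \<alpha> \<delta> \<epsilon> \<rho> \<eta> L :: real and K :: "nat set"
  assumes irr: "\<alpha> \<notin> \<rat>" and \<delta>: "0 < \<delta>" and \<epsilon>: "0 < \<epsilon>" and \<rho>: "\<rho> > 2 * \<delta> + \<epsilon>" and L: "L \<ge> 0"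
    and K: "\<forall>\<^sub>F N in sequentially. real (card (K \<inter> {1..N})) \<ge> \<rho> * real N"
    and hom: "\<And>m. m \<ge> 1 \<Longrightarrow> block_entropy B p n \<le> block_entropy B p (m * n) / real m + \<eta> * real n"
    and big: "\<delta> * L > ln 2 + \<eta> * real n"
  shows "\<exists>M\<subseteq>words B n. card M \<le> nat \<lceil>ln (1 / \<delta>) * exp L\<rceil> \<and>
    emeasure lborel (A_set (K \<inter> {k. word \<omega> k n \<in> M}) \<alpha>) \<ge> ennreal \<epsilon>"
proof -
  define P where "P = exp (- L)"
  have P: "0 < P" "P \<le> 1" using L by (auto simp: P_def)
  define cell where "cell q k = \<lfloor>real q * frac (real k * \<alpha>)\<rfloor>" for q k :: nat
  define E where "E q i = {word \<omega> k n | k. k \<in> K \<and> cell q k = i}" for q i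
  have E: "E q i \<subseteq> words B n" for q i using word_in_words by (auto simp: E_def)
  define m where "m = nat \<lceil>ln (1 / \<delta>) * exp L\<rceil>"
  \<comment> \<open>The slack in the density; for \<open>q \<ge> q0 + 2\<close> it outweighs the
    loss from counting cell visits with frequency \<open>1 / (q - 1)\<close> instead of
    \<open>1 / q\<close>.\<close>
  define \<tau> where "\<tau> = \<rho> - 2 * \<delta> - \<epsilon>"
  have \<tau>: "\<tau> > 0" using \<rho> by (simp add: \<tau>_def)
  obtain q0 :: nat where q0: "real q0 > (\<epsilon> + \<delta>) / \<tau>" using reals_Archimedean2 by blast
  define cover where "cover q M \<longleftrightarrow>
      real (card {i\<in>{0..<int q}. \<exists>k\<in>K. word \<omega> k n \<in> M \<and> cell q k = i}) \<ge> \<epsilon> * real q" for q M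
  have cells: "cell q k \<in> {0..<int q}" if "q \<ge> 1" for q k
  proof -
    have "real q * frac (real k * \<alpha>) < real q * 1"
      using that by (intro mult_strict_left_mono frac_lt_1) auto
    then show ?thesis by (simp add: cell_def floor_less_iff)
  qed
  have ex: "\<exists>M\<subseteq>words B n. card M \<le> m \<and> cover q M" if q: "q \<ge> q0 + 2" for q
  proof -
    define good where "good = {i\<in>{0..<int q}. sum p (E q i) > P}"
    have fin_good: "finite good"
      unfolding good_def by (rule finite_subset[of _ "{0..<int q}"]) auto
    have q2: "q \<ge> 2" using q by simp
    obtain s where s: "\<And>N i. (q - 1) * card {k\<in>{1..N}. cell q k = i} \<le> N + s"
      unfolding cell_def using rotation_cell_count[OF irr q2] by blast
    have card_good: "real (card good) \<ge> (\<epsilon> + \<delta>) * real q"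
    proof (rule ccontr)
      assume "\<not> ?thesis"
      then have few: "real (card good) < (\<epsilon> + \<delta>) * real q" by simp
      \<comment> \<open>Few good cells would absorb only about \<epsilon> + \<delta> of all times,
        so the times of \<open>K\<close> in the remaining cells would have lower density at least
        \<delta>, because \<rho> exceeds \<open>2 * \<delta> + \<epsilon>\<close>.\<close>
      define J where "J = {k\<in>K. cell q k \<notin> good}"
      have count: "real (q - 1) * real (card {k\<in>{1..N}. cell q k \<in> good}) \<le> (\<epsilon> + \<delta>) * real q * real (N + s)" for N
      proof -
        have "{k\<in>{1..N}. cell q k \<in> good} = (\<Union>i\<in>good. {k\<in>{1..N}. cell q k = i})" by auto
        then have "card {k\<in>{1..N}. cell q k \<in> good} \<le> (\<Sum>i\<in>good. card {k\<in>{1..N}. cell q k = i})"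
          using card_UN_le[OF fin_good] by simp
        then have "(q - 1) * card {k\<in>{1..N}. cell q k \<in> good} \<le> (q - 1) * (\<Sum>i\<in>good. card {k\<in>{1..N}. cell q k = i})"
          by (rule mult_le_mono2)
        also have "\<dots> \<le> (\<Sum>i\<in>good. N + s)"
          unfolding sum_distrib_left by (intro sum_mono s)
        finally have "(q - 1) * card {k\<in>{1..N}. cell q k \<in> good} \<le> card good * (N + s)" by simp
        then have "real (q - 1) * real (card {k\<in>{1..N}. cell q k \<in> good}) \<le> real (card good) * real (N + s)"
          by (metis of_nat_le_iff of_nat_mult)
        also have "\<dots> \<le> (\<epsilon> + \<delta>) * real q * real (N + s)"
          using few by (intro mult_right_mono) auto
        finally show ?thesis .
      qed
      \<comment> \<open>\<open>d / (q - 1)\<close> is the margin by which the estimated density of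
        \<open>J\<close> exceeds \<delta>; \<open>N0\<close> lets it outweigh the bounded error
        caused by \<open>s\<close>.\<close>
      define d where "d = (\<rho> - \<delta>) * real (q - 1) - (\<epsilon> + \<delta>) * real q"
      have "(\<epsilon> + \<delta>) < \<tau> * real (q - 1)"
      proof -
        have "real (q - 1) > (\<epsilon> + \<delta>) / \<tau>" using q q0 by linarith
        then show ?thesis using \<tau> by (simp add: field_simps)
      qed
      moreover have "d = \<tau> * real (q - 1) - (\<epsilon> + \<delta>)"
        using q2 by (simp add: d_def \<tau>_def of_nat_diff algebra_simps)
      ultimately have d: "d > 0" by simp
      obtain N0 :: nat where N0: "real N0 \<ge> (\<epsilon> + \<delta>) * real q * real s / d"
        using real_arch_simple by blast
      have dens: "\<forall>\<^sub>F N in sequentially. real (card (J \<inter> {1..N})) \<ge> \<delta> * real N"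
        using K eventually_ge_at_top[of N0]
      proof eventually_elim
        case (elim N)
        have "K \<inter> {1..N} \<subseteq> (J \<inter> {1..N}) \<union> {k\<in>{1..N}. cell q k \<in> good}" by (auto simp: J_def)
        then have "card (K \<inter> {1..N}) \<le> card ((J \<inter> {1..N}) \<union> {k\<in>{1..N}. cell q k \<in> good})"
          by (intro card_mono) auto
        also have "\<dots> \<le> card (J \<inter> {1..N}) + card {k\<in>{1..N}. cell q k \<in> good}" by (rule card_Un_le)
        finally have le: "\<rho> * real N - real (card {k\<in>{1..N}. cell q k \<in> good}) \<le> real (card (J \<inter> {1..N}))"
          using elim(1) by linarith
        have "(\<epsilon> + \<delta>) * real q * real s \<le> d * real N"
        proof -
          have "(\<epsilon> + \<delta>) * real q * real s / d \<le> real N" using N0 elim(2) by linarith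
          then show ?thesis using d by (simp add: pos_divide_le_eq mult.commute)
        qed
        then have "real (q - 1) * (\<delta> * real N) \<le> real (q - 1) * (\<rho> * real N) - (\<epsilon> + \<delta>) * real q * real (N + s)"
          by (simp add: d_def algebra_simps)
        also have "\<dots> \<le> real (q - 1) * (\<rho> * real N) - real (q - 1) * real (card {k\<in>{1..N}. cell q k \<in> good})"
          using count[of N] by linarith
        also have "\<dots> = real (q - 1) * (\<rho> * real N - real (card {k\<in>{1..N}. cell q k \<in> good}))"
          by (simp add: right_diff_distrib)
        finally have "\<delta> * real N \<le> \<rho> * real N - real (card {k\<in>{1..N}. cell q k \<in> good})"
          using q2 by (subst (asm) mult_le_cancel_left_pos) auto
        then show ?case using le by linarith
      qed
      have q1: "q \<ge> 1" using q2 by simp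
      have "\<delta> * - ln P \<le> ln 2 + \<eta> * real n"
      proof (rule visible_density_le[where i = "cell q" and E = "E q" and J = J and q = q])
        show "k \<in> J \<Longrightarrow> word \<omega> k n \<in> E q (cell q k)" for k by (auto simp: J_def E_def)
        show "k \<in> J \<Longrightarrow> sum p (E q (cell q k)) \<le> P" for k
          using cells[OF q1, of k] by (auto simp: J_def good_def)
        show "finite (range (\<lambda>k. map (\<lambda>j. cell q (k + j * n)) [0..<m]))" for m
          unfolding cell_def by (rule rotation_patterns(1)[OF q1])
        show "card (range (\<lambda>k. map (\<lambda>j. cell q (k + j * n)) [0..<m])) \<le> q * m + 1" for m
          unfolding cell_def by (rule rotation_patterns(2)[OF q1])
      qed (use E P dens hom in auto)
      then show False using big by (simp add: P_def)
    qed
    have "\<exists>M\<subseteq>words B n. card M \<le> m \<and> real (card {i\<in>good. E q i \<inter> M = {}}) \<le> (1 - P) ^ m * real (card good)"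
      by (rule greedy_cover[where p = p and E = "E q", OF finite_words[OF finite_alphabet] fin_good p_nonneg sum_p E])
        (use P in \<open>auto simp: good_def\<close>)
    then obtain M where M: "M \<subseteq> words B n" "card M \<le> m"
      and miss: "real (card {i\<in>good. E q i \<inter> M = {}}) \<le> (1 - P) ^ m * real (card good)" by blast
    \<comment> \<open>The choice of \<open>m\<close> gives
      \<open>m * P \<ge> ln (1 / \<delta>)\<close>, whence at most a fraction \<delta> of the good
      cells is missed.\<close>
    have "(1 - P) ^ m \<le> exp (- P) ^ m"
      using P exp_ge_add_one_self[of "- P"] by (intro power_mono) auto
    also have "\<dots> = exp (- (real m * P))" by (simp add: exp_of_nat_mult[symmetric])
    also have "\<dots> \<le> exp (- ln (1 / \<delta>))"
    proof -
      have "ln (1 / \<delta>) * exp L \<le> real m" unfolding m_def by linarith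
      then have "ln (1 / \<delta>) * exp L * P \<le> real m * P" using P by (intro mult_right_mono) auto
      moreover have "exp L * P = 1" by (simp add: P_def exp_minus)
      ultimately show ?thesis by (simp add: mult.assoc del: mult_minus_left)
    qed
    also have "\<dots> = \<delta>" using \<delta> by (simp add: ln_div)
    finally have "(1 - P) ^ m * real (card good) \<le> \<delta> * real q"
    proof (rule mult_mono)
      have "card good \<le> card {0..<int q}" by (intro card_mono) (auto simp: good_def)
      then show "real (card good) \<le> real q" by simp
    qed (use \<delta> in auto)
    then have miss': "real (card {i\<in>good. E q i \<inter> M = {}}) \<le> \<delta> * real q" using miss by linarith
    let ?hit = "{i\<in>{0..<int q}. \<exists>k\<in>K. word \<omega> k n \<in> M \<and> cell q k = i}"
    have fin_hit: "finite ?hit" by (rule finite_subset[of _ "{0..<int q}"]) auto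
    have "good \<subseteq> {i\<in>good. E q i \<inter> M = {}} \<union> ?hit"
    proof
      fix i assume i: "i \<in> good"
      show "i \<in> {i\<in>good. E q i \<inter> M = {}} \<union> ?hit"
      proof (cases "E q i \<inter> M = {}")
        case False
        then obtain k where "k \<in> K" "cell q k = i" "word \<omega> k n \<in> M" by (auto simp: E_def)
        then show ?thesis using i by (auto simp: good_def)
      qed (use i in simp)
    qed
    then have "card good \<le> card ({i\<in>good. E q i \<inter> M = {}} \<union> ?hit)"
      using fin_good fin_hit by (intro card_mono) simp_all
    also have "\<dots> \<le> card {i\<in>good. E q i \<inter> M = {}} + card ?hit" by (rule card_Un_le)
    finally have "real (card good) \<le> \<delta> * real q + real (card ?hit)" using miss' by linarith
    then have "cover q M" using card_good unfolding cover_def by (simp add: algebra_simps)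
    then show ?thesis using M by blast
  qed
  then have "\<forall>q. \<exists>M. q \<ge> q0 + 2 \<longrightarrow> M \<subseteq> words B n \<and> card M \<le> m \<and> cover q M" by blast
  from choice[OF this] obtain F where
    F: "\<And>q. q \<ge> q0 + 2 \<Longrightarrow> F q \<subseteq> words B n \<and> card (F q) \<le> m \<and> cover q (F q)" by blast
  \<comment> \<open>The words found may depend on \<open>q\<close>. There are finitely many sets of
    words of length \<open>n\<close>, so one set \<open>M\<close> serves infinitely many grids, as
    the measure estimate requires.\<close>
  have "finite (F ` {q0 + 2..})"
    by (rule finite_subset[of _ "Pow (words B n)"]) (use F finite_words[OF finite_alphabet] in auto)
  then obtain q1 where q1: "q1 \<ge> q0 + 2" "infinite {q\<in>{q0 + 2..}. F q = F q1}"
    using pigeonhole_infinite[of "{q0 + 2..}" F] infinite_Ici by auto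
  define M where "M = F q1"
  have M: "M \<subseteq> words B n" "card M \<le> m" using F[OF q1(1)] by (auto simp: M_def)
  let ?T = "(\<lambda>k. frac (real k * \<alpha>)) ` (K \<inter> {k. word \<omega> k n \<in> M})"
  have "{q\<in>{q0 + 2..}. F q = F q1} \<subseteq>
      {q::nat. real (card {i\<in>{0..<int q}. \<exists>t\<in>?T. \<lfloor>real q * t\<rfloor> = i}) \<ge> \<epsilon> * real q}"
  proof
    fix q assume "q \<in> {q\<in>{q0 + 2..}. F q = F q1}"
    then have "cover q M" using F[of q] by (auto simp: M_def)
    moreover have "{i\<in>{0..<int q}. \<exists>t\<in>?T. \<lfloor>real q * t\<rfloor> = i} =
        {i\<in>{0..<int q}. \<exists>k\<in>K. word \<omega> k n \<in> M \<and> cell q k = i}" by (auto simp: cell_def)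
    ultimately show "q \<in> {q::nat. real (card {i\<in>{0..<int q}. \<exists>t\<in>?T. \<lfloor>real q * t\<rfloor> = i}) \<ge> \<epsilon> * real q}"
      by (simp add: cover_def)
  qed
  then have "infinite {q::nat. real (card {i\<in>{0..<int q}. \<exists>t\<in>?T. \<lfloor>real q * t\<rfloor> = i}) \<ge> \<epsilon> * real q}"
    using q1(2) infinite_super by blast
  then have "emeasure lborel (A_set (K \<inter> {k. word \<omega> k n \<in> M}) \<alpha>) \<ge> ennreal \<epsilon>"
    unfolding A_set_def by (intro emeasure_closure_ge_hit_cells) (auto simp: frac_lt_1)
  then show ?thesis using M unfolding m_def by blast
qed

section \<open>Itineraries of ergodic maps\<close>

definition itinerary :: "('a \<Rightarrow> 'a) \<Rightarrow> 'a set set \<Rightarrow> 'a \<Rightarrow> nat \<Rightarrow> 'a set" where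
  "itinerary S P x k = (THE A. A \<in> P \<and> (S ^^ k) x \<in> A)"

text \<open>Defined through the itinerary instead of by intersecting preimages, so that for a
  partition \<open>P\<close> a word with a letter outside \<open>P\<close> gets the empty set and
  thus weight 0.\<close>

definition cylinder :: "('a \<Rightarrow> 'a) \<Rightarrow> 'a set set \<Rightarrow> 'a set list \<Rightarrow> 'a set" where
  "cylinder S P v = {x. word (itinerary S P x) 0 (length v) = v}"

context
  fixes M :: "'a measure" and S :: "'a \<Rightarrow> 'a" and P :: "'a set set"
  assumes part: "fin_partition M P" and space: "space M = UNIV"
begin

lemma itinerary_eq_iff: "A \<in> P \<Longrightarrow> itinerary S P x k = A \<longleftrightarrow> (S ^^ k) x \<in> A"
  and itinerary_mem: "itinerary S P x k \<in> P"
proof -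
  have "(S ^^ k) x \<in> \<Union>P" using part space by (auto simp: fin_partition_def)
  then obtain B where B: "B \<in> P" "(S ^^ k) x \<in> B" by blast
  have disj: "\<forall>A\<in>P. \<forall>B\<in>P. A \<noteq> B \<longrightarrow> A \<inter> B = {}" using part by (simp add: fin_partition_def)
  have uniq: "A = B" if "A \<in> P" "(S ^^ k) x \<in> A" for A
  proof (rule ccontr)
    assume "A \<noteq> B"
    then have "A \<inter> B = {}" using disj that(1) B(1) by simp
    then show False using that(2) B(2) by blast
  qed
  have *: "itinerary S P x k = B"
    unfolding itinerary_def
  proof (rule the_equality)
    show "B \<in> P \<and> (S ^^ k) x \<in> B" using B by (rule conjI)
    show "A = B" if "A \<in> P \<and> (S ^^ k) x \<in> A" for A
      using that by (elim conjE) (rule uniq)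
  qed
  show "itinerary S P x k \<in> P" using * B by simp
  show "A \<in> P \<Longrightarrow> itinerary S P x k = A \<longleftrightarrow> (S ^^ k) x \<in> A"
    unfolding * using B(2) uniq by blast
qed

lemma word_itinerary_eq_iff: "word (itinerary S P x) k (length v) = v \<longleftrightarrow> (S ^^ k) x \<in> cylinder S P v"
proof -
  have "itinerary S P ((S ^^ k) x) = (\<lambda>j. itinerary S P x (k + j))"
    by (simp add: itinerary_def fun_eq_iff funpow_add add.commute)
  then show ?thesis by (simp add: cylinder_def word_def)
qed

lemma cylinder_eq: "set v \<subseteq> P \<Longrightarrow> cylinder S P v = {x. \<forall>j<length v. (S ^^ j) x \<in> v ! j}"
proof -
  assume v: "set v \<subseteq> P"
  have "word w 0 (length v) = v \<longleftrightarrow> (\<forall>j<length v. w j = v ! j)" for w :: "nat \<Rightarrow> 'a set"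
  proof -
    have nth: "word w 0 (length v) ! j = w j" if "j < length v" for j
      using that by (simp add: word_def)
    show ?thesis
    proof
      assume "word w 0 (length v) = v"
      then show "\<forall>j<length v. w j = v ! j" using nth by metis
    next
      assume "\<forall>j<length v. w j = v ! j"
      then show "word w 0 (length v) = v" using nth by (intro nth_equalityI) auto
    qed
  qed
  then have "cylinder S P v = {x. \<forall>j<length v. itinerary S P x j = v ! j}"
    unfolding cylinder_def by simp
  moreover have "itinerary S P x j = v ! j \<longleftrightarrow> (S ^^ j) x \<in> v ! j" if "j < length v" for x j
    by (rule itinerary_eq_iff) (use v nth_mem[OF that] in blast)
  ultimately show "cylinder S P v = {x. \<forall>j<length v. (S ^^ j) x \<in> v ! j}" by simp
qed

lemma cylinder_empty: "\<not> set v \<subseteq> P \<Longrightarrow> cylinder S P v = {}"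
proof -
  have "set v \<subseteq> P" if "x \<in> cylinder S P v" for x
  proof -
    have "set v = set (word (itinerary S P x) 0 (length v))" using that by (simp add: cylinder_def)
    also have "\<dots> \<subseteq> P" using itinerary_mem by (auto simp: word_def)
    finally show ?thesis .
  qed
  then show "\<not> set v \<subseteq> P \<Longrightarrow> cylinder S P v = {}" by blast
qed

text \<open>The join up to \<open>n\<close> involves the \<open>n + 1\<close> iterates from the
  identity on, so its atoms belong to words of length \<open>Suc n\<close>.\<close>

lemma cylinder_in_join_atoms:
  assumes "v \<in> words P (Suc n)" "cylinder S P v \<noteq> {}"
  shows "cylinder S P v \<in> join_atoms S P n"
proof -
  have v: "set v \<subseteq> P" "length v = Suc n" using assms by (auto simp: words_def)
  then have "\<forall>j\<le>n. v ! j \<in> P" by (auto simp: subset_iff)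
  moreover have "cylinder S P v = {x. \<forall>j\<le>n. (S ^^ j) x \<in> v ! j}"
    using v by (simp add: cylinder_eq less_Suc_eq_le)
  ultimately show ?thesis using assms(2) unfolding join_atoms_def by blast
qed

context
  assumes S: "S \<in> M \<rightarrow>\<^sub>M M"
begin

lemma measurable_funpow: "S ^^ k \<in> M \<rightarrow>\<^sub>M M"
proof (induction k)
  case (Suc k)
  show ?case unfolding funpow.simps by (rule measurable_comp[OF Suc S])
qed simp

lemma sets_cylinder: "cylinder S P v \<in> sets M"
proof (cases "set v \<subseteq> P")
  case True
  have "cylinder S P v = {x\<in>space M. \<forall>j\<in>{..<length v}. x \<in> (S ^^ j) -` (v ! j) \<inter> space M}"
    using cylinder_eq[OF True] space by auto
  also have "\<dots> \<in> sets M"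
  proof (intro sets.sets_Collect_finite_All)
    fix j assume "j \<in> {..<length v}"
    then have "v ! j \<in> sets M" using True part by (auto simp: fin_partition_def subset_iff)
    then have "(S ^^ j) -` (v ! j) \<inter> space M \<in> sets M" by (rule measurable_sets[OF measurable_funpow])
    moreover have "{x\<in>space M. x \<in> (S ^^ j) -` (v ! j) \<inter> space M} = (S ^^ j) -` (v ! j) \<inter> space M" by blast
    ultimately show "{x\<in>space M. x \<in> (S ^^ j) -` (v ! j) \<inter> space M} \<in> sets M" by (simp only:)
  qed simp
  finally show ?thesis .
qed (simp add: cylinder_empty)

end

end

text \<open>There are countably many words over \<open>P\<close>, so one null set serves for the
  frequencies of all cylinders. Almost every orbit also avoids all cylinders of measure 0, because
  preimages of null sets under iterates are null; hence every word read has positive weight.\<close>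

lemma (in prob_space) AE_generic_itinerary:
  assumes part: "fin_partition M P" and space: "space M = UNIV" and erg: "ergodic_map M S"
  shows "AE x in M. generic_sequence P (itinerary S P x) (\<lambda>v. measure M (cylinder S P v))"
proof -
  have mp: "measure_preserving_map M S" using erg by (simp add: ergodic_map_def)
  then have S: "S \<in> M \<rightarrow>\<^sub>M M" by (simp add: measure_preserving_map_def)
  have finP: "finite P" using part by (simp add: fin_partition_def)
  have cnt: "countable (lists P)" using finP by (intro countable_lists countable_finite)
  note cyl = sets_cylinder[OF part space S]
  have freq: "AE x in M. \<forall>v\<in>lists P.
      (\<lambda>N. real (card {k\<in>{1..N}. (S ^^ k) x \<in> cylinder S P v}) / real N) \<longlonglongrightarrow> measure M (cylinder S P v)"
    using ergodic_frequency[OF erg cyl] by (simp add: AE_ball_countable[OF cnt])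
  have null: "(S ^^ k) -` E \<inter> space M \<in> null_sets M" if "E \<in> null_sets M" for k E
    using that
  proof (induction k arbitrary: E)
    case (Suc k)
    have "S -` E \<inter> space M \<in> null_sets M"
      using Suc.prems mp measurable_sets[OF S, of E] by (auto simp: null_sets_def measure_preserving_map_def)
    then have "(S ^^ k) -` (S -` E \<inter> space M) \<inter> space M \<in> null_sets M" by (rule Suc.IH)
    then show ?case using space by (simp add: vimage_def)
  qed (use space in simp)
  have "AE x in M. \<forall>v\<in>{v\<in>lists P. measure M (cylinder S P v) = 0}. \<forall>k. (S ^^ k) x \<notin> cylinder S P v"
  proof (subst AE_ball_countable)
    show "countable {v\<in>lists P. measure M (cylinder S P v) = 0}"
      using cnt by (rule countable_subset[rotated]) auto
    show "\<forall>v\<in>{v\<in>lists P. measure M (cylinder S P v) = 0}. AE x in M. \<forall>k. (S ^^ k) x \<notin> cylinder S P v"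
    proof (intro ballI, subst AE_all_countable, intro allI)
      fix v k assume "v \<in> {v\<in>lists P. measure M (cylinder S P v) = 0}"
      then have "cylinder S P v \<in> null_sets M" using cyl[of v] by (simp add: null_sets_def emeasure_eq_measure)
      then have "AE x in M. x \<notin> (S ^^ k) -` cylinder S P v \<inter> space M" by (intro AE_not_in null)
      then show "AE x in M. (S ^^ k) x \<notin> cylinder S P v" using space by simp
    qed
  qed
  then show ?thesis
    using freq
  proof eventually_elim
    case (elim x)
    show ?case
    proof
      show "finite P" by (rule finP)
      show "itinerary S P x k \<in> P" for k by (rule itinerary_mem[OF part space])
      show "(\<lambda>N. real (card {k\<in>{1..N}. word (itinerary S P x) k (length v) = v}) / real N)
          \<longlonglongrightarrow> measure M (cylinder S P v)" for v
        using elim(2) cylinder_empty[OF part space, of v S]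
        unfolding word_itinerary_eq_iff[OF part space]
        by (cases "set v \<subseteq> P") (auto simp: lists_eq_set)
      show "measure M (cylinder S P (word (itinerary S P x) k n)) > 0" for k n
      proof -
        let ?v = "word (itinerary S P x) k n"
        have "?v \<in> lists P" using itinerary_mem[OF part space] by (auto simp: word_def)
        moreover have "(S ^^ k) x \<in> cylinder S P ?v"
          using word_itinerary_eq_iff[OF part space, of S x k ?v] by simp
        ultimately have "measure M (cylinder S P ?v) \<noteq> 0" using elim(1) by blast
        then show ?thesis by (simp add: less_le)
      qed
    qed
  qed
qed

section \<open>Uniform constants and passage to atoms of the join\<close>

theorem theorem9p9:
  fixes \<mu> :: "'a::metric_space measure" and S :: "'a \<Rightarrow> 'a"
    and \<A> :: "'a set set" and \<epsilon> \<alpha> :: real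
  assumes compactX: "compact (UNIV :: 'a set)"
    and borel: "sets \<mu> = sets borel"
    and prob: "prob_space \<mu>"
    and erg: "ergodic_map \<mu> S"
    and hpos: "ks_entropy \<mu> S > 0"
    and part: "fin_partition \<mu> \<A>"
    and gen: "sigma_sets UNIV {(S ^^ i) -` A | i A. A \<in> \<A>} = sets borel"
    and bdry: "\<forall>i. \<forall>A\<in>\<A>. measure \<mu> (frontier ((S ^^ i) -` A)) = 0"
    and eps: "0 < \<epsilon>" "\<epsilon> < 1"
    and alpha: "0 < \<alpha>" "\<alpha> < 1" "\<alpha> \<notin> \<rat>"
  shows "\<forall>\<delta>. 0 < \<delta> \<and> \<delta> < 1 \<longrightarrow>
    (\<exists>c>0. \<exists>X'. X' \<in> sets \<mu> \<and> measure \<mu> X' = 1 \<and>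
      (\<forall>n\<ge>1. \<forall>x\<in>X'. \<forall>K :: nat set. lower_density K > ereal (2 * \<delta> + \<epsilon>) \<longrightarrow>
         (\<exists>\<M>. \<M> \<subseteq> join_atoms S \<A> n \<and> finite \<M> \<and>
            real (card \<M>) \<le> c * 2 powr (real n * \<delta>) \<and>
            emeasure lborel (A_set (K \<inter> {k. (S ^^ k) x \<in> \<Union>\<M>}) \<alpha>) \<ge> ennreal \<epsilon>)))"
proof (intro allI impI, elim conjE)
  fix \<delta> :: real assume \<delta>: "0 < \<delta>" "\<delta> < 1"
  interpret prob_space \<mu> by (rule prob)
  have space: "space \<mu> = UNIV" using sets_eq_imp_space_eq[OF borel] by simp
  define p where "p v = measure \<mu> (cylinder S \<A> v)" for v
  let ?G = "\<lambda>x. generic_sequence \<A> (itinerary S \<A> x) p"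
  let ?H = "block_entropy \<A> p"
  have "AE x in \<mu>. ?G x"
    unfolding p_def by (rule AE_generic_itinerary[OF part space erg])
  then obtain Z where Z: "{x\<in>space \<mu>. \<not> ?G x} \<subseteq> Z" "emeasure \<mu> Z = 0" "Z \<in> sets \<mu>"
    by (rule AE_E)
  have "measure \<mu> Z = 0" using Z(2) by (simp add: measure_def)
  define X' where "X' = space \<mu> - Z"
  have X': "X' \<in> sets \<mu>" "measure \<mu> X' = 1" "\<And>x. x \<in> X' \<Longrightarrow> ?G x"
    using Z \<open>measure \<mu> Z = 0\<close> prob_compl[OF Z(3)] by (auto simp: X'_def)
  \<comment> \<open>The weights \<open>p\<close> do not depend on the point, so entropy facts
    obtained along one generic orbit give a threshold \<open>n1\<close> valid for every
    \<open>x\<close> and \<open>K\<close>.\<close>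
  have "X' \<noteq> {}" using X'(2) by auto
  then obtain x0 where "x0 \<in> X'" by blast
  then have "?G x0" by (rule X'(3))
  then interpret G0: generic_sequence \<A> "itinerary S \<A> x0" p .
  \<comment> \<open>With \<open>L = m * \<delta> * ln 2\<close> the saving
    \<open>\<delta> * L\<close> is \<open>\<delta>\<^sup>2 * m * ln 2\<close>. Spending a quarter of
    this rate on the defect leaves room for the overhead \<open>ln 2\<close> once
    \<open>\<delta>\<^sup>2 * m \<ge> 4\<close>, which \<open>n2\<close> ensures.\<close>
  define \<eta> where "\<eta> = \<delta>\<^sup>2 * ln 2 / 4"
  have \<eta>: "\<eta> > 0" using \<delta> by (simp add: \<eta>_def)
  obtain n1 where n1: "\<And>n m. n \<ge> n1 \<Longrightarrow> m \<ge> 1 \<Longrightarrow> ?H n \<le> ?H (m * n) / real m + \<eta> * real n"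
    using subadditive_almost_homogeneous[of ?H, OF G0.block_entropy_add_le G0.block_entropy_nonneg \<eta>] by blast
  obtain n2 :: nat where n2: "real n2 \<ge> 4 / \<delta>\<^sup>2" using real_arch_simple by blast
  define n0 where "n0 = max n1 n2"
  \<comment> \<open>The factor \<open>2 powr (real n0 * \<delta>)\<close> pays for small
    \<open>n\<close>, where words of length \<open>n0 + 1\<close> stand in for words of length
    \<open>n + 1\<close>.\<close>
  define c where "c = (ln (1 / \<delta>) + 1) * 2 powr (real n0 * \<delta>)"
  have ln_pos: "ln (1 / \<delta>) > 0" using \<delta> by (simp add: ln_gt_zero)
  have c: "c > 0" using ln_pos by (simp add: c_def)
  have "\<exists>\<M>. \<M> \<subseteq> join_atoms S \<A> n \<and> finite \<M> \<and> real (card \<M>) \<le> c * 2 powr (real n * \<delta>) \<and>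
      emeasure lborel (A_set (K \<inter> {k. (S ^^ k) x \<in> \<Union>\<M>}) \<alpha>) \<ge> ennreal \<epsilon>"
    if x: "x \<in> X'" and K: "lower_density K > ereal (2 * \<delta> + \<epsilon>)" for n x K
  proof -
    interpret G: generic_sequence \<A> "itinerary S \<A> x" p by (rule X'(3)[OF x])
    define m where "m = max n n0"
    define L where "L = real m * \<delta> * ln 2"
    obtain \<rho> where \<rho>: "2 * \<delta> + \<epsilon> < \<rho>" "ereal \<rho> < lower_density K"
      using ereal_dense2[OF K] by auto
    have dens: "\<forall>\<^sub>F N in sequentially. real (card (K \<inter> {1..N})) \<ge> \<rho> * real N"
      using less_LiminfD[OF \<rho>(2)[unfolded lower_density_def]] eventually_gt_at_top[of 0]
      by eventually_elim (simp add: field_simps)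
    have big: "\<delta> * L > ln 2 + \<eta> * real (Suc m)"
    proof -
      have "4 / \<delta>\<^sup>2 \<le> real m" using n2 by (simp add: m_def n0_def)
      then have "4 \<le> \<delta>\<^sup>2 * real m" using \<delta> by (simp add: field_simps)
      moreover have "\<delta>\<^sup>2 < 1" using \<delta> by (simp add: power_less_one_iff)
      moreover have "1 + (y + z) / 4 < y" if "4 \<le> y" "z < 1" for y z :: real
        using that by (simp add: field_simps)
      ultimately have "1 + (\<delta>\<^sup>2 * real m + \<delta>\<^sup>2) / 4 < \<delta>\<^sup>2 * real m" by blast
      then have "(1 + (\<delta>\<^sup>2 * real m + \<delta>\<^sup>2) / 4) * ln 2 < (\<delta>\<^sup>2 * real m) * ln 2"
        by (rule mult_strict_right_mono) simp
      then show ?thesis by (simp add: L_def \<eta>_def power2_eq_square algebra_simps)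
    qed
    have L: "L \<ge> 0" using \<delta> by (simp add: L_def)
    have hom: "?H (Suc m) \<le> ?H (j * Suc m) / real j + \<eta> * real (Suc m)" if "j \<ge> 1" for j
      by (rule n1) (use that in \<open>auto simp: m_def n0_def\<close>)
    obtain M where M: "M \<subseteq> words \<A> (Suc m)" "card M \<le> nat \<lceil>ln (1 / \<delta>) * exp L\<rceil>"
      and A: "emeasure lborel (A_set (K \<inter> {k. word (itinerary S \<A> x) k (Suc m) \<in> M}) \<alpha>) \<ge> ennreal \<epsilon>"
      using G.few_words_cover[OF alpha(3) \<delta>(1) eps(1) \<rho>(1) L dens hom big] by blast
    \<comment> \<open>Truncation to \<open>n + 1\<close> letters can only enlarge the union of the
      cylinders and does not increase the number of words; empty cylinders are dropped because atoms
      are nonempty.\<close>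
    define \<M> where "\<M> = cylinder S \<A> ` {v \<in> take (Suc n) ` M. cylinder S \<A> v \<noteq> {}}"
    have finM: "finite M" using M(1) finite_words[OF G.finite_alphabet] by (rule finite_subset)
    have "\<M> \<subseteq> join_atoms S \<A> n"
    proof
      fix C assume "C \<in> \<M>"
      then obtain w where w: "w \<in> M" "C = cylinder S \<A> (take (Suc n) w)" "C \<noteq> {}" by (auto simp: \<M>_def)
      have "take (Suc n) w \<in> words \<A> (Suc n)"
        using w(1) M(1) by (auto simp: words_def m_def dest!: in_set_takeD)
      then show "C \<in> join_atoms S \<A> n"
        using w cylinder_in_join_atoms[OF part space] by blast
    qed
    moreover have "finite \<M>" using finM by (simp add: \<M>_def)
    moreover have "real (card \<M>) \<le> c * 2 powr (real n * \<delta>)"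
    proof -
      have "card \<M> \<le> card {v \<in> take (Suc n) ` M. cylinder S \<A> v \<noteq> {}}"
        unfolding \<M>_def using finM by (intro card_image_le) simp
      also have "\<dots> \<le> card (take (Suc n) ` M)" using finM by (intro card_mono) auto
      also have "\<dots> \<le> card M" using finM by (rule card_image_le)
      finally have "real (card \<M>) \<le> real (nat \<lceil>ln (1 / \<delta>) * exp L\<rceil>)" using M(2) by simp
      also have "\<dots> \<le> ln (1 / \<delta>) * exp L + 1"
      proof -
        have "0 \<le> ln (1 / \<delta>) * exp L" using ln_pos by (intro mult_nonneg_nonneg) auto
        then show ?thesis by linarith
      qed
      \<comment> \<open>The rounding term 1 is absorbed by \<open>exp L \<ge> 1\<close>.\<close>
      also have "\<dots> \<le> (ln (1 / \<delta>) + 1) * exp L" using L by (simp add: algebra_simps)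
      also have "exp L = 2 powr (real m * \<delta>)" by (simp add: L_def powr_def)
      also have "(ln (1 / \<delta>) + 1) * 2 powr (real m * \<delta>) \<le> (ln (1 / \<delta>) + 1) * 2 powr (real n0 * \<delta> + real n * \<delta>)"
      proof -
        have "real m * \<delta> \<le> (real n0 + real n) * \<delta>" using \<delta> by (intro mult_right_mono) (auto simp: m_def)
        then show ?thesis using ln_pos by (intro mult_left_mono powr_mono) (auto simp: algebra_simps)
      qed
      also have "\<dots> = c * 2 powr (real n * \<delta>)" by (simp add: c_def powr_add)
      finally show ?thesis .
    qed
    moreover have "emeasure lborel (A_set (K \<inter> {k. (S ^^ k) x \<in> \<Union>\<M>}) \<alpha>) \<ge> ennreal \<epsilon>"
    proof -
      have "(S ^^ k) x \<in> \<Union>\<M>" if k: "word (itinerary S \<A> x) k (Suc m) \<in> M" for k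
      proof -
        let ?v = "word (itinerary S \<A> x) k (Suc n)"
        have "Suc m = Suc n + (m - n)" by (simp add: m_def)
        then have "take (Suc n) (word (itinerary S \<A> x) k (Suc m)) = ?v"
          using word_append[of "itinerary S \<A> x" k "Suc n" "m - n"] by simp
        then have "?v \<in> take (Suc n) ` M" using k by force
        moreover have "(S ^^ k) x \<in> cylinder S \<A> ?v"
          using word_itinerary_eq_iff[OF part space, of S x k ?v] by simp
        ultimately have "cylinder S \<A> ?v \<in> \<M>" unfolding \<M>_def by blast
        then show ?thesis using \<open>(S ^^ k) x \<in> cylinder S \<A> ?v\<close> by blast
      qed
      then have "A_set (K \<inter> {k. word (itinerary S \<A> x) k (Suc m) \<in> M}) \<alpha> \<subseteq> A_set (K \<inter> {k. (S ^^ k) x \<in> \<Union>\<M>}) \<alpha>"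
        unfolding A_set_def by (intro closure_mono image_mono) auto
      then have "emeasure lborel (A_set (K \<inter> {k. word (itinerary S \<A> x) k (Suc m) \<in> M}) \<alpha>) \<le>
          emeasure lborel (A_set (K \<inter> {k. (S ^^ k) x \<in> \<Union>\<M>}) \<alpha>)"
        by (rule emeasure_mono) (simp add: A_set_def)
      then show ?thesis using A by (rule order_trans[rotated])
    qed
    ultimately show ?thesis by blast
  qed
  then show "\<exists>c>0. \<exists>X'. X' \<in> sets \<mu> \<and> measure \<mu> X' = 1 \<and>
      (\<forall>n\<ge>1. \<forall>x\<in>X'. \<forall>K :: nat set. lower_density K > ereal (2 * \<delta> + \<epsilon>) \<longrightarrow>
         (\<exists>\<M>. \<M> \<subseteq> join_atoms S \<A> n \<and> finite \<M> \<and>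
            real (card \<M>) \<le> c * 2 powr (real n * \<delta>) \<and>
            emeasure lborel (A_set (K \<inter> {k. (S ^^ k) x \<in> \<Union>\<M>}) \<alpha>) \<ge> ennreal \<epsilon>))"
    using c X'(1,2) by blast
qed

end
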